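(* Let $X$ be a Polish space and let $c:[X]^2\to 2$ be a reduced pair-coloring. Then $\mathfrak{hm}(c)=\mathfrak{hm}(c_{\min})$ or $\mathfrak{hm}(c)=\mathfrak{hm}(c_{\max})$.
   Context: $[X]^2$ is the set of two-element subsets of $X$, topologized as the quotient of $X^2\setminus\{(x,x):x\in X\}$ by identifying $(x,y)$ with $(y,x)$. A pair-coloring $c:[X]^2\to 2=\{0,1\}$ is continuous if $c^{-1}(0)$ and $c^{-1}(1)$ are open (equivalently, for every pair $\{x,y\}$ there are disjoint open $U\ni x$, $V\ni y$ with $c$ constant on pairs from $U\times V$). A set $H\subseteq X$ is $c$-homogeneous if $c$ is constant on $[H]^2$. The homogeneity number $\mathfrak{hm}(c)$ is the least cardinality of a family of $c$-homogeneous sets covering $X$. $c$ is reduced if it is continuous and no nonempty open subset of $X$ is $c$-homogeneous. For $x\neq y$ in $\omega^{\le\omega}$, $\Delta(x,y)=\min\{n:x(n)\ne y(n)\}$. $c_{\min}:[2^\omega]^2\to 2$ is $c_{\min}(x,y)=\Delta(x,y)\bmod 2$. Fix the random (Rado) graph on $\omega$ with edge-relation characteristic function $\chi:[\omega]^2\to 2$. $c_{\max}$ is the coloring on the compact space $\prod_{n\in\omega}(n+1)$ (homeomorphic to $2^\omega$) given by $c_{\max}(x,y)=\chi(\{x(n),y(n)\})$ where $n=\Delta(x,y)$. *)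

theory Defs
  imports "HOL-Analysis.Analysis" "HOL-Library.Ramsey" "HOL-Library.Nat_Bijection"
begin

unbundle cardinal_syntax

definition Polish_space :: "'a topology \<Rightarrow> bool" where
  "Polish_space X \<longleftrightarrow> completely_metrizable_space X \<and> separable_space X"

definition off_diagonal :: "'a topology \<Rightarrow> ('a \<times> 'a) topology" where
  "off_diagonal X = subtopology (prod_topology X X) {(x, y). x \<noteq> y}"

text \<open>The quotient topology on unordered pairs; see \<open>quotient_map_pair_topology\<close> below.\<close>

definition pair_topology :: "'a topology \<Rightarrow> 'a set topology" where
  "pair_topology X = topology (\<lambda>U. U \<subseteq> [topspace X]\<^bsup>2\<^esup> \<and>
     openin (off_diagonal X) {z \<in> topspace (off_diagonal X). {fst z, snd z} \<in> U})"

lemma openin_pair_topology: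
  "openin (pair_topology X) U \<longleftrightarrow> U \<subseteq> [topspace X]\<^bsup>2\<^esup> \<and>
     openin (off_diagonal X) {z \<in> topspace (off_diagonal X). {fst z, snd z} \<in> U}"
proof -
  let ?O = "off_diagonal X"
  let ?P = "\<lambda>U. {z \<in> topspace ?O. {fst z, snd z} \<in> U}"
  have "istopology (\<lambda>U. U \<subseteq> [topspace X]\<^bsup>2\<^esup> \<and> openin ?O (?P U))"
    unfolding istopology_def
  proof (intro conjI allI impI)
    fix S T
    assume S: "S \<subseteq> [topspace X]\<^bsup>2\<^esup> \<and> openin ?O (?P S)"
      and T: "T \<subseteq> [topspace X]\<^bsup>2\<^esup> \<and> openin ?O (?P T)"
    show "S \<inter> T \<subseteq> [topspace X]\<^bsup>2\<^esup>"
      using S by blast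
    have "?P (S \<inter> T) = ?P S \<inter> ?P T"
      by blast
    then show "openin ?O (?P (S \<inter> T))"
      using S T by auto
  next
    fix K
    assume K: "\<forall>S\<in>K. S \<subseteq> [topspace X]\<^bsup>2\<^esup> \<and> openin ?O (?P S)"
    show "\<Union>K \<subseteq> [topspace X]\<^bsup>2\<^esup>"
      using K by blast
    have "?P (\<Union>K) = (\<Union>S\<in>K. ?P S)"
      by blast
    then show "openin ?O (?P (\<Union>K))"
      using K by auto
  qed
  then show ?thesis
    by (simp add: pair_topology_def topology_inverse')
qed

lemma topspace_off_diagonal:
  "topspace (off_diagonal X) = {(x, y). x \<in> topspace X \<and> y \<in> topspace X \<and> x \<noteq> y}"
  by (auto simp: off_diagonal_def)

lemma topspace_pair_topology: "topspace (pair_topology X) = [topspace X]\<^bsup>2\<^esup>"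
proof -
  have "{z \<in> topspace (off_diagonal X). {fst z, snd z} \<in> [topspace X]\<^bsup>2\<^esup>} = topspace (off_diagonal X)"
    by (auto simp: topspace_off_diagonal)
  then have "openin (pair_topology X) ([topspace X]\<^bsup>2\<^esup>)"
    by (simp add: openin_pair_topology)
  then show ?thesis
    using openin_pair_topology[of X "topspace (pair_topology X)"] openin_subset by fastforce
qed

lemma quotient_map_pair_topology:
  "quotient_map (off_diagonal X) (pair_topology X) (\<lambda>z. {fst z, snd z})"
proof -
  have "(\<lambda>z. {fst z, snd z}) ` topspace (off_diagonal X) = [topspace X]\<^bsup>2\<^esup>"
  proof (intro equalityI subsetI)
    fix p
    assume "p \<in> [topspace X]\<^bsup>2\<^esup>"
    then obtain x y where "p = {x, y}" "x \<in> topspace X" "y \<in> topspace X" "x \<noteq> y"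
      by (rule nsets2_E)
    then show "p \<in> (\<lambda>z. {fst z, snd z}) ` topspace (off_diagonal X)"
      by (intro image_eqI[of _ _ "(x, y)"]) (auto simp: topspace_off_diagonal)
  qed (auto simp: topspace_off_diagonal)
  then show ?thesis
    by (auto simp: quotient_map_def topspace_pair_topology openin_pair_topology)
qed

definition continuous_coloring :: "'a topology \<Rightarrow> ('a set \<Rightarrow> nat) \<Rightarrow> bool" where
  "continuous_coloring X c \<longleftrightarrow> c \<in> [topspace X]\<^bsup>2\<^esup> \<rightarrow> {0, 1} \<and>
     (\<forall>i\<in>{0, 1}. openin (pair_topology X) {p \<in> [topspace X]\<^bsup>2\<^esup>. c p = i})"

definition homogeneous :: "('a set \<Rightarrow> nat) \<Rightarrow> 'a set \<Rightarrow> bool" where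
  "homogeneous c H \<longleftrightarrow> (\<exists>i. \<forall>p\<in>[H]\<^bsup>2\<^esup>. c p = i)"

definition reduced_coloring :: "'a topology \<Rightarrow> ('a set \<Rightarrow> nat) \<Rightarrow> bool" where
  "reduced_coloring X c \<longleftrightarrow> continuous_coloring X c \<and>
     (\<forall>U. openin X U \<and> U \<noteq> {} \<longrightarrow> \<not> homogeneous c U)"

definition homogeneous_cover :: "'a set \<Rightarrow> ('a set \<Rightarrow> nat) \<Rightarrow> 'a set set \<Rightarrow> bool" where
  "homogeneous_cover S c F \<longleftrightarrow> (\<forall>H\<in>F. H \<subseteq> S \<and> homogeneous c H) \<and> \<Union>F = S"

text \<open>Cardinals are represented by cardinal orders and compared by \<open>=o\<close> and \<open>\<le>o\<close>; \<open>hm S c\<close> is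
  determined up to \<open>=o\<close>.\<close>

definition hm :: "'a set \<Rightarrow> ('a set \<Rightarrow> nat) \<Rightarrow> 'a set rel" where
  "hm S c = (SOME r. (\<exists>F. homogeneous_cover S c F \<and> r = |F| ) \<and>
     (\<forall>G. homogeneous_cover S c G \<longrightarrow> r \<le>o |G| ))"

lemma hm_least:
  "(\<exists>F. homogeneous_cover S c F \<and> hm S c = |F| ) \<and>
     (\<forall>G. homogeneous_cover S c G \<longrightarrow> hm S c \<le>o |G| )"
proof -
  let ?R = "card_of ` {F. homogeneous_cover S c F}"
  have "homogeneous_cover S c ((\<lambda>x. {x}) ` S)"
    by (auto simp: homogeneous_cover_def homogeneous_def nsets_2_eq)
  then have "?R \<noteq> {}"
    by blast
  moreover have "\<forall>r\<in>?R. Card_order r"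
    using card_of_Card_order by blast
  ultimately have "\<exists>r\<in>?R. \<forall>r'\<in>?R. r \<le>o r'"
    by (rule exists_minim_Card_order)
  then have "\<exists>r. (\<exists>F. homogeneous_cover S c F \<and> r = |F| ) \<and>
     (\<forall>G. homogeneous_cover S c G \<longrightarrow> r \<le>o |G| )"
    by auto
  then show ?thesis
    unfolding hm_def by (rule someI_ex)
qed

definition Delta :: "(nat \<Rightarrow> 'a) \<Rightarrow> (nat \<Rightarrow> 'a) \<Rightarrow> nat" where
  "Delta x y = (LEAST n. x n \<noteq> y n)"

text \<open>The first splitting level of an unordered pair; see \<open>pair_Delta_doubleton\<close>.\<close>

definition pair_Delta :: "(nat \<Rightarrow> 'a) set \<Rightarrow> nat" where
  "pair_Delta p = (LEAST n. \<exists>x\<in>p. \<exists>y\<in>p. x n \<noteq> y n)"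

lemma pair_Delta_doubleton: "pair_Delta {x, y} = Delta x y"
  unfolding pair_Delta_def Delta_def by (rule arg_cong[where f = Least]) auto

definition cantor_space :: "(nat \<Rightarrow> nat) set" where
  "cantor_space = (\<Pi>\<^sub>E n\<in>UNIV. {0, 1})"

definition c_min :: "(nat \<Rightarrow> nat) set \<Rightarrow> nat" where
  "c_min p = pair_Delta p mod 2"

lemma c_min_doubleton: "c_min {x, y} = Delta x y mod 2"
  by (simp add: c_min_def pair_Delta_doubleton)

text \<open>The extension property characterises the countable random graph up to isomorphism.\<close>

definition random_graph :: "(nat set \<Rightarrow> nat) \<Rightarrow> bool" where
  "random_graph adj \<longleftrightarrow> adj \<in> [UNIV]\<^bsup>2\<^esup> \<rightarrow> {0, 1} \<and>
     (\<forall>A B. finite A \<and> finite B \<and> A \<inter> B = {} \<longrightarrow>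
        (\<exists>v. v \<notin> A \<union> B \<and> (\<forall>a\<in>A. adj {v, a} = 1) \<and> (\<forall>b\<in>B. adj {v, b} = 0)))"

lemma random_graph_exists: "\<exists>adj. random_graph adj"
proof
  let ?adj = "\<lambda>p::nat set. if Min p \<in> set_decode (Max p) then 1 else 0 :: nat"
  show "random_graph ?adj"
    unfolding random_graph_def
  proof (intro conjI allI impI)
    fix A B :: "nat set"
    assume AB: "finite A \<and> finite B \<and> A \<inter> B = {}"
    define N where "N = Suc (Max (insert 0 (A \<union> B)))"
    define v where "v = set_encode (insert N A)"
    have lt: "a < N" if "a \<in> A \<union> B" for a
      using that AB by (simp add: N_def less_Suc_eq_le)
    have dec: "set_decode v = insert N A"
      using AB by (simp add: v_def)
    have "N \<notin> A"
      using lt by blast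
    then have "v = 2 ^ N + set_encode A"
      using AB by (simp add: v_def)
    then have "N < v"
      using less_exp[of N] by linarith
    then have ord: "Min {v, a} = a" "Max {v, a} = v" "a \<noteq> v" "a \<noteq> N" if "a \<in> A \<union> B" for a
      using lt[OF that] by auto
    show "\<exists>v. v \<notin> A \<union> B \<and> (\<forall>a\<in>A. ?adj {v, a} = 1) \<and> (\<forall>b\<in>B. ?adj {v, b} = 0)"
    proof (intro exI[of _ v] conjI ballI)
      show "v \<notin> A \<union> B"
        using ord(3) by blast
      show "?adj {v, a} = 1" if "a \<in> A" for a
        using that ord[of a] dec by simp
      show "?adj {v, b} = 0" if "b \<in> B" for b
        using that ord[of b] dec AB by auto
    qed
  qed auto
qed

definition max_space :: "(nat \<Rightarrow> nat) set" where
  "max_space = (\<Pi>\<^sub>E n\<in>UNIV. {..<n + 1})"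

definition c_max :: "(nat set \<Rightarrow> nat) \<Rightarrow> (nat \<Rightarrow> nat) set \<Rightarrow> nat" where
  "c_max adj p = adj ((\<lambda>x. x (pair_Delta p)) ` p)"

lemma c_max_doubleton: "c_max adj {x, y} = adj {x (Delta x y), y (Delta x y)}"
  by (simp add: c_max_def pair_Delta_doubleton)

end

theory Submission
  imports Defs
begin

text \<open>
  The parity coloring embeds into every reduced coloring by a Cantor scheme, so
  \<open>hm(c_min) \<le> hm(c)\<close>. Splitting the coordinates of the Cantor space into two halves turns homogeneous
  sets of \<open>c_min\<close> into graphs of functions between the halves, and Sierpinski's argument on covering
  the plane by such graphs shows that the continuum is at most the successor of \<open>hm(c_min)\<close>. Hence
  the dichotomy follows from \<open>hm(c) \<le> hm(c_max)\<close>.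

  For the latter, Lipschitz properties of these functions bound the dominating number by
  \<open>hm(c_min)\<close>, so that the Polish space is covered by \<open>hm(c_max)\<close> many compact zero-dimensional
  pieces. On a compact piece, \<open>c\<close> is governed by three colorings in which the color of a pair depends
  only on the two nodes where the pair splits, and these embed into \<open>c_max\<close> because the random graph
  contains every countable graph.
\<close>

section \<open>Homogeneity numbers\<close>

text \<open>The two alternatives meet at the continuum. Sierpinski's argument says that strictly
  above hm(c_min) no infinite cardinal lies below the continuum, while hm(c_max) is at most the
  continuum, since singletons cover. So hm(c_min) < hm(c) gives hm(c_max) \<le> continuum \<le>
  hm(c). The obstacle for hm(c) \<le> hm(c_max) is that a Polish space need be neither compact nor
  zero-dimensional, whereas points of \<open>max_space\<close> are sequences with finitely many
  values at each place. A function \<open>f\<close> that prescribes gaps below the radii of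
  countably many balls and sizes of finite nets cuts out a piece with both properties, and a
  dominating family leaves only few \<open>f\<close> to treat. All the cardinals involved are
  infinite, so products and unions of few covers cost nothing.\<close>

lemma homogeneous_iff:
  "homogeneous c H \<longleftrightarrow> (\<exists>i. \<forall>x\<in>H. \<forall>y\<in>H. x \<noteq> y \<longrightarrow> c {x, y} = i)"
  unfolding homogeneous_def by (force simp: nsets_2_eq)

lemma hm_cover:
  obtains F where "homogeneous_cover S c F" "hm S c = |F|"
  using hm_least[of S c] by blast

lemma homogeneous_cover_mem:
  "homogeneous_cover S c F \<Longrightarrow> x \<in> S \<Longrightarrow> \<exists>H\<in>F. x \<in> H"
  unfolding homogeneous_cover_def by blast

lemma homogeneous_coverE:
  assumes "homogeneous_cover S c F" "H \<in> F"
  obtains i where "\<forall>x\<in>H. \<forall>y\<in>H. x \<noteq> y \<longrightarrow> c {x, y} = i"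
  using assms unfolding homogeneous_cover_def homogeneous_iff by blast

text \<open>An index set in place of a set of sets lets covers be indexed by products and dependent
  sums, whose cardinality is easy to bound.\<close>

lemma hm_leI:
  assumes "\<And>x. x \<in> S \<Longrightarrow> \<exists>a\<in>A. x \<in> H a" and "\<And>a. a \<in> A \<Longrightarrow> homogeneous c (H a \<inter> S)"
  shows "hm S c \<le>o |A|"
proof -
  let ?G = "(\<lambda>a. H a \<inter> S) ` A"
  have "homogeneous_cover S c ?G"
    unfolding homogeneous_cover_def using assms by blast
  then have "hm S c \<le>o |?G|"
    using hm_least[of S c] by blast
  then show ?thesis
    by (rule ordLeq_transitive) (rule card_of_image)
qed

lemma hm_le_card: "hm S c \<le>o |S|"
  by (rule hm_leI[where H = "\<lambda>x. {x}"]) (auto simp: homogeneous_iff)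

text \<open>Homogeneous sets pull back along color-preserving maps; injectivity keeps pairs from
  collapsing to points.\<close>

lemma hm_mono_embedding:
  assumes emb: "\<And>x. x \<in> S \<Longrightarrow> \<phi> x \<in> T"
    and inj: "inj_on \<phi> S"
    and col: "\<And>x y. x \<in> S \<Longrightarrow> y \<in> S \<Longrightarrow> x \<noteq> y \<Longrightarrow> e {\<phi> x, \<phi> y} = c {x, y}"
  shows "hm S c \<le>o hm T e"
proof -
  obtain F where F: "homogeneous_cover T e F" "hm T e = |F|"
    by (rule hm_cover)
  have "hm S c \<le>o |F|"
  proof (rule hm_leI[where H = "\<lambda>H. \<phi> -` H"])
    fix x assume "x \<in> S"
    then show "\<exists>a\<in>F. x \<in> \<phi> -` a"
      using F(1) emb unfolding homogeneous_cover_def by blast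
  next
    fix H assume "H \<in> F"
    with F(1) obtain i where i [rule_format]: "\<forall>x\<in>H. \<forall>y\<in>H. x \<noteq> y \<longrightarrow> e {x, y} = i"
      by (rule homogeneous_coverE)
    have "c {x, y} = i" if "x \<in> \<phi> -` H \<inter> S" "y \<in> \<phi> -` H \<inter> S" "x \<noteq> y" for x y
      using that i[of "\<phi> x" "\<phi> y"] col[of x y] inj by (auto dest: inj_onD)
    then show "homogeneous c (\<phi> -` H \<inter> S)"
      unfolding homogeneous_iff by blast
  qed
  then show ?thesis
    using F(2) by simp
qed

section \<open>First differences of sequences\<close>

lemma Delta_eqI: "x n \<noteq> y n \<Longrightarrow> (\<And>m. m < n \<Longrightarrow> x m = y m) \<Longrightarrow> Delta x y = n"
  unfolding Delta_def by (rule Least_equality) (auto simp: not_less[symmetric])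

lemma Delta_neq: "x \<noteq> y \<Longrightarrow> x (Delta x y) \<noteq> y (Delta x y)"
  unfolding Delta_def by (rule LeastI_ex) auto

lemma Delta_least: "m < Delta x y \<Longrightarrow> x m = y m"
  unfolding Delta_def using not_less_Least by blast

section \<open>Lower bounds for the homogeneity number of the parity coloring\<close>

text \<open>A homogeneous set in which no two points first differ at an odd place is, after splitting
  coordinates into even and odd ones, the graph of a function of the even coordinates.\<close>

definition interleave :: "(nat \<Rightarrow> bool) \<Rightarrow> (nat \<Rightarrow> bool) \<Rightarrow> nat \<Rightarrow> nat" where
  "interleave x y n = of_bool (if even n then x (n div 2) else y (n div 2))"

lemma interleave_in_cantor_space: "interleave x y \<in> cantor_space"
  by (auto simp: cantor_space_def interleave_def)

lemma interleave_even [simp]: "interleave x y (2 * n) = of_bool (x n)"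
  and interleave_odd [simp]: "interleave x y (Suc (2 * n)) = of_bool (y n)"
  by (simp_all add: interleave_def)

lemma interleave_eq_iff: "interleave x y = interleave x' y' \<longleftrightarrow> x = x' \<and> y = y'"
proof
  assume eq: "interleave x y = interleave x' y'"
  have "x n = x' n" "y n = y' n" for n
    using fun_cong[OF eq, of "2 * n"] fun_cong[OF eq, of "Suc (2 * n)"]
    by (simp_all only: interleave_even interleave_odd of_bool_eq_iff)
  then show "x = x' \<and> y = y'"
    by blast
qed auto

lemma interleave_below:
  assumes "m < 2 * P" "\<And>q. q < P \<Longrightarrow> x q = x' q \<and> y q = y' q"
  shows "interleave x y m = interleave x' y' m"
  using assms(1) assms(2)[of "m div 2"] by (auto simp: interleave_def)

lemma c_min_interleave_same_left:
  assumes "y \<noteq> y'"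
  shows "c_min {interleave x y, interleave x y'} = 1"
proof -
  have "Delta (interleave x y) (interleave x y') = Suc (2 * Delta y y')"
  proof (rule Delta_eqI)
    fix m assume "m < Suc (2 * Delta y y')"
    then show "interleave x y m = interleave x y' m"
      using Delta_least[of "m div 2" y y'] by (cases "even m") (auto simp: interleave_def elim!: oddE)
  qed (use Delta_neq[OF assms] in auto)
  then show ?thesis
    by (simp add: c_min_doubleton)
qed

text \<open>The left bit \<open>P\<close> stands at place \<open>2 * P\<close>, just before the
  right bit \<open>P\<close>, so the right halves need to agree only strictly below
  \<open>P\<close>.\<close>

lemma c_min_interleave_left:
  assumes "x P \<noteq> x' P" "\<And>q. q < P \<Longrightarrow> x q = x' q \<and> y q = y' q"
  shows "c_min {interleave x y, interleave x' y'} = 0"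
proof -
  have "Delta (interleave x y) (interleave x' y') = 2 * P"
  proof (rule Delta_eqI)
    show "interleave x y (2 * P) \<noteq> interleave x' y' (2 * P)"
      using assms(1) by (simp only: interleave_even of_bool_eq_iff not_False_eq_True)
    show "interleave x y m = interleave x' y' m" if "m < 2 * P" for m
      using that assms(2) by (rule interleave_below)
  qed
  then show ?thesis
    by (simp add: c_min_doubleton)
qed

lemma c_min_interleave_same_right:
  assumes "x \<noteq> x'"
  shows "c_min {interleave x y, interleave x' y} = 0"
  using c_min_interleave_left[of x "Delta x x'" x' y y] assms Delta_neq Delta_least by blast

section \<open>Sierpinski's argument: the continuum against covers for the parity coloring\<close>

text \<open>For each \<open>x\<close>, some \<open>interleave x e\<close> with \<open>e \<in> E\<close> lies in a set where the right half
  determines the left one; so \<open>x\<close> is recovered from \<open>e\<close> and that set.\<close>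

lemma continuum_le_of_c_min_cover:
  fixes E :: "(nat \<Rightarrow> bool) set"
  assumes F: "homogeneous_cover cantor_space c_min F" and E: "infinite E" and lt: "|F| <o |E|"
  shows "|UNIV :: (nat \<Rightarrow> bool) set| \<le>o |E|"
proof -
  define Z where "Z = {H \<in> F. \<forall>x y x' y'. interleave x y \<in> H \<longrightarrow> interleave x' y' \<in> H \<longrightarrow> x = x' \<longrightarrow> y = y'}"
  define f where "f p = (SOME x. interleave x (fst p) \<in> snd p)" for p :: "(nat \<Rightarrow> bool) \<times> (nat \<Rightarrow> nat) set"
  have "x \<in> f ` (E \<times> F)" for x
  proof -
    have "\<exists>e\<in>E. \<exists>H\<in>F - Z. interleave x e \<in> H"
    proof (rule ccontr)
      assume neg: "\<not> ?thesis"
      have "\<forall>e\<in>E. \<exists>H\<in>Z. interleave x e \<in> H"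
      proof
        fix e assume "e \<in> E"
        moreover obtain H where "H \<in> F" "interleave x e \<in> H"
          using homogeneous_cover_mem[OF F interleave_in_cantor_space] by blast
        ultimately show "\<exists>H\<in>Z. interleave x e \<in> H"
          using neg by blast
      qed
      then obtain h where h: "\<And>e. e \<in> E \<Longrightarrow> h e \<in> Z \<and> interleave x e \<in> h e"
        by metis
      \<comment> \<open>A member of \<open>Z\<close> has at most one point with left half
        \<open>x\<close>, so different \<open>e\<close> need different members.\<close>
      have "inj_on h E"
      proof (rule inj_onI)
        fix e e' assume a: "e \<in> E" "e' \<in> E" "h e = h e'"
        then have "interleave x e \<in> h e" "interleave x e' \<in> h e" "h e \<in> Z"
          using h[of e] h[of e'] by auto
        then show "e = e'"
          unfolding Z_def by blast
      qed
      then have "|E| \<le>o |F|"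
        by (rule card_of_ordLeqI) (use h Z_def in blast)
      then show False
        using lt by (simp add: not_ordLess_ordLeq)
    qed
    then obtain e H where eH: "e \<in> E" "H \<in> F" "H \<notin> Z" "interleave x e \<in> H"
      by blast
    from F eH(2) obtain i where
      i [rule_format]: "\<forall>u\<in>H. \<forall>v\<in>H. u \<noteq> v \<longrightarrow> c_min {u, v} = i"
      by (rule homogeneous_coverE)
    from eH(2,3) obtain a b b' where "interleave a b \<in> H" "interleave a b' \<in> H" "b \<noteq> b'"
      unfolding Z_def by blast
    \<comment> \<open>Two points of \<open>H\<close> over the same left half first differ at an odd
      place. Two points over the same right half would have color 0, so \<open>H\<close> and
      \<open>e\<close> determine \<open>x\<close>.\<close>
    then have "i = 1"
      using i[of "interleave a b" "interleave a b'"] c_min_interleave_same_left[of b b' a]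
      by (simp add: interleave_eq_iff)
    have "interleave (f (e, H)) e \<in> H"
      unfolding f_def fst_conv snd_conv by (rule someI[of "\<lambda>x. interleave x e \<in> H"]) (rule eH(4))
    then have "f (e, H) = x"
      using i[of "interleave (f (e, H)) e" "interleave x e"] eH(4) \<open>i = 1\<close>
        c_min_interleave_same_right[of "f (e, H)" x e] by (auto simp: interleave_eq_iff)
    then show ?thesis
      using eH by force
  qed
  then have "|UNIV :: (nat \<Rightarrow> bool) set| \<le>o |f ` (E \<times> F)|"
    by (intro card_of_mono1 subsetI)
  also have "|f ` (E \<times> F)| \<le>o |E \<times> F|"
    by (rule card_of_image)
  also have "|E \<times> F| \<le>o |E|"
    using E lt by (intro card_of_Sigma_ordLeq_infinite) (auto intro: ordLess_imp_ordLeq card_of_mono1)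
  finally show ?thesis .
qed

lemma uncountable_bool_seq: "uncountable (UNIV :: (nat \<Rightarrow> bool) set)"
proof
  assume "countable (UNIV :: (nat \<Rightarrow> bool) set)"
  then obtain f :: "nat \<Rightarrow> nat \<Rightarrow> bool" where f: "range f = UNIV"
    using uncountable_def by blast
  then obtain n where "f n = (\<lambda>k. \<not> f k k)"
    by (metis UNIV_I imageE)
  then have "f n n = (\<not> f n n)"
    by (rule fun_cong)
  then show False
    by simp
qed

text \<open>If \<open>F\<close> were finite, the continuum bound would apply to a countably infinite
  \<open>E\<close>, here the indicators of initial segments, and make the Cantor space
  countable.\<close>

lemma c_min_cover_infinite:
  assumes "homogeneous_cover cantor_space c_min F"
  shows "infinite F"
proof
  assume "finite F"
  let ?E = "range (\<lambda>n k. k < (n::nat))"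
  have "inj (\<lambda>n k. k < (n::nat))"
    by (rule injI) (metis less_irrefl linorder_neqE_nat)
  then have E: "infinite ?E"
    using finite_imageD infinite_UNIV_nat by blast
  then have "|F| <o |?E|"
    using \<open>finite F\<close> by (intro finite_ordLess_infinite) (auto simp: Field_card_of card_of_well_order_on)
  then have "|UNIV :: (nat \<Rightarrow> bool) set| \<le>o |?E|"
    by (rule continuum_le_of_c_min_cover[OF assms E])
  then have "\<exists>g :: (nat \<Rightarrow> bool) \<Rightarrow> (nat \<Rightarrow> bool). inj g \<and> range g \<subseteq> ?E"
    by (simp only: card_of_ordLeq)
  then obtain g :: "(nat \<Rightarrow> bool) \<Rightarrow> (nat \<Rightarrow> bool)" where "inj g" "range g \<subseteq> ?E"
    by (elim exE conjE)
  moreover have "countable ?E"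
    by simp
  ultimately have "countable (UNIV :: (nat \<Rightarrow> bool) set)"
    using countable_image_inj_on[of g UNIV] countable_subset[of "range g" ?E] by simp
  then show False
    using uncountable_bool_seq by blast
qed

text \<open>A function is recovered from the indicator of its graph, coded by pairing.\<close>

lemma nat_seq_card_le_bool_seq: "|A :: (nat \<Rightarrow> nat) set| \<le>o |UNIV :: (nat \<Rightarrow> bool) set|"
proof -
  let ?g = "\<lambda>f k. f (fst (prod_decode k)) = snd (prod_decode k)"
  have "inj_on ?g A"
  proof (rule inj_onI)
    fix f f' assume eq: "?g f = ?g f'"
    have "f a = f' a" for a
      using fun_cong[OF eq, of "prod_encode (a, f a)"] by simp
    then show "f = f'"
      by blast
  qed
  then show ?thesis
    by (rule card_of_ordLeqI) simp
qed

section \<open>A dominating family from a cover for the parity coloring\<close>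

text \<open>The right half carries bits of \<open>e\<close> at the places in the range of \<open>g\<close> only. If it determines the
  left half place by place, then \<open>g n\<close> depends only on \<open>g\<close> and \<open>e\<close> below \<open>n\<close>.\<close>

definition sparse_code :: "(nat \<Rightarrow> nat) \<Rightarrow> (nat \<Rightarrow> bool) \<Rightarrow> nat \<Rightarrow> nat" where
  "sparse_code g e = interleave (\<lambda>p. p \<in> range g) (\<lambda>p. \<exists>n. p = g n \<and> e n)"

lemma sparse_code_inj:
  assumes "inj g" "sparse_code g e = sparse_code g e'"
  shows "e = e'"
proof
  fix n
  have "(\<exists>m. g n = g m \<and> e m) = (\<exists>m. g n = g m \<and> e' m)"
    using assms(2) unfolding sparse_code_def interleave_eq_iff by meson
  then show "e n = e' n"
    using assms(1) by (auto dest: injD)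
qed

lemma c_min_sparse_code_same:
  assumes "inj g" "e \<noteq> e'"
  shows "c_min {sparse_code g e, sparse_code g e'} = 1"
  unfolding sparse_code_def
proof (rule c_min_interleave_same_left)
  show "(\<lambda>p. \<exists>n. p = g n \<and> e n) \<noteq> (\<lambda>p. \<exists>n. p = g n \<and> e' n)"
    using assms sparse_code_inj[of g e e'] by (auto simp: sparse_code_def)
qed

text \<open>The place \<open>g n\<close> is in the range of \<open>g\<close> but not of
  \<open>g'\<close>: earlier values of \<open>g'\<close> equal those of \<open>g\<close>, hence are
  smaller, and later ones are larger. Below \<open>g n\<close> only indices under \<open>n\<close>
  matter, where everything agrees, so the first difference is the left bit at
  \<open>g n\<close>.\<close>

lemma c_min_sparse_code_split:
  assumes g: "strict_mono g" "strict_mono g'"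
    and eq: "\<And>i. i < n \<Longrightarrow> g i = g' i \<and> e i = e' i" and lt: "g n < g' n"
  shows "c_min {sparse_code g e, sparse_code g' e'} = 0" "sparse_code g e \<noteq> sparse_code g' e'"
proof -
  have less: "i < n" if "g' i < g' n" for i
    using that g(2) by (simp only: strict_mono_less)
  have split: "g n \<notin> range g'"
  proof
    assume "g n \<in> range g'"
    then obtain i where i: "g n = g' i"
      by (rule rangeE)
    then have "i < n"
      using lt by (intro less) simp
    then show False
      using eq[of i] i strict_monoD[OF g(1), of i n] by simp
  qed
  have small: "i < n" if "g i < g n" for i
    using that g(1) by (simp only: strict_mono_less)
  have small': "i < n" if "g' i < g n" for i
    using that lt by (intro less) simp
  have below: "(q \<in> range g) = (q \<in> range g') \<and> (\<exists>n. q = g n \<and> e n) = (\<exists>n. q = g' n \<and> e' n)"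
    if "q < g n" for q
    using that small small' eq unfolding image_iff by (metis UNIV_I)
  then show "c_min {sparse_code g e, sparse_code g' e'} = 0"
    unfolding sparse_code_def by (intro c_min_interleave_left[where P = "g n"]) (use split in blast)+
  show "sparse_code g e \<noteq> sparse_code g' e'"
    unfolding sparse_code_def interleave_eq_iff using split by (metis rangeI)
qed

text \<open>Two codes in \<open>H\<close> that agree below \<open>n\<close> must have the same
  \<open>g n\<close>, as otherwise they form a pair of color 0. An initial segment of
  \<open>(g, e)\<close> thus has at most two extensions, by the bit \<open>e n\<close>, and the tree
  of initial segments is finitely branching.\<close>

lemma finite_sparse_code_values:
  assumes H: "\<And>u v. u \<in> H \<Longrightarrow> v \<in> H \<Longrightarrow> u \<noteq> v \<Longrightarrow> c_min {u, v} \<noteq> 0"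
  shows "finite {g n |g e. strict_mono g \<and> sparse_code g e \<in> H}"
proof -
  define R where "R = {(g, e). strict_mono g \<and> sparse_code g e \<in> H}"
  define r where "r n = (\<lambda>(g :: nat \<Rightarrow> nat, e :: nat \<Rightarrow> bool). (map g [0..<n], map e [0..<n]))" for n :: nat
  have not_less: "\<not> g n < g' n"
    if mem: "strict_mono g" "strict_mono g'" "sparse_code g e \<in> H" "sparse_code g' e' \<in> H"
      and eq: "map g [0..<n] = map g' [0..<n]" "map e [0..<n] = map e' [0..<n]" for g g' e e' n
  proof
    assume lt: "g n < g' n"
    have "g i = g' i \<and> e i = e' i" if "i < n" for i
      using eq that unfolding map_eq_conv by simp
    note c_min_sparse_code_split[OF mem(1,2) this lt]
    then show False
      using H[OF mem(3,4)] by simp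
  qed
  have det: "fst a n = fst b n" if ab: "a \<in> R" "b \<in> R" "r n a = r n b" for a b n
  proof (cases a, cases b)
    fix g e g' e' assume a: "a = (g, e)" and b: "b = (g', e')"
    have mem: "strict_mono g" "strict_mono g'" "sparse_code g e \<in> H" "sparse_code g' e' \<in> H"
      using ab(1,2) unfolding R_def a b by simp_all
    have eq: "map g [0..<n] = map g' [0..<n]" "map e [0..<n] = map e' [0..<n]"
      using ab(3) unfolding r_def a b by simp_all
    show ?thesis
      using not_less[OF mem eq] not_less[OF mem(2,1,4,3) eq[symmetric]] a b by simp
  qed
  have fin: "finite (r n ` R)" for n
  proof (induction n)
    case 0
    have "r 0 ` R \<subseteq> {([], [])}"
      by (auto simp: r_def)
    then show ?case
      by (rule finite_subset) simp
  next
    case (Suc n)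
    \<comment> \<open>A representative of the initial segment \<open>p\<close>; its value at
      \<open>n\<close> is the only possible one.\<close>
    define s where "s p = (SOME a. a \<in> R \<and> r n a = p)" for p
    have "r (Suc n) ` R \<subseteq> (\<lambda>(p, b). (fst p @ [fst (s p) n], snd p @ [b])) ` (r n ` R \<times> UNIV)"
    proof (rule image_subsetI)
      fix a assume a: "a \<in> R"
      have "s (r n a) \<in> R \<and> r n (s (r n a)) = r n a"
        unfolding s_def by (rule someI[of _ a]) (use a in simp)
      then have "fst (s (r n a)) n = fst a n"
        using det a by blast
      then have "r (Suc n) a = (\<lambda>(p, b). (fst p @ [fst (s p) n], snd p @ [b])) (r n a, snd a n)"
        by (cases a) (simp add: r_def)
      then show "r (Suc n) a \<in> (\<lambda>(p, b). (fst p @ [fst (s p) n], snd p @ [b])) ` (r n ` R \<times> UNIV)"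
        using a by blast
    qed
    then show ?case
      by (rule finite_subset) (intro finite_imageI finite_cartesian_product Suc finite)
  qed
  have "{g n |g e. strict_mono g \<and> sparse_code g e \<in> H} \<subseteq> (\<lambda>p. fst p ! n) ` r (Suc n) ` R"
  proof
    fix k assume "k \<in> {g n |g e. strict_mono g \<and> sparse_code g e \<in> H}"
    then obtain g e where ge: "k = g n" "(g, e) \<in> R"
      unfolding R_def by auto
    have "k = fst (r (Suc n) (g, e)) ! n"
      unfolding r_def ge(1) by (simp add: nth_append)
    then show "k \<in> (\<lambda>p. fst p ! n) ` r (Suc n) ` R"
      using ge(2) by blast
  qed
  then show ?thesis
    by (rule finite_subset) (intro finite_imageI fin)
qed

text \<open>If \<open>F\<close> is smaller than the continuum, then for each \<open>g\<close> some
  member of \<open>F\<close> contains the codes of \<open>g\<close> with two different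
  \<open>e\<close>. Its color is 1, so it allows only finitely many values at each \<open>n\<close>,
  and their maximum bounds \<open>g\<close>.\<close>

lemma dominating_family_of_c_min_cover:
  assumes F: "homogeneous_cover cantor_space c_min F"
  obtains D :: "(nat \<Rightarrow> nat) set"
  where "|D| \<le>o |F|" "\<And>f. \<exists>h\<in>D. \<forall>n. f n \<le> h n"
proof (cases "|UNIV :: (nat \<Rightarrow> bool) set| \<le>o |F|")
  case True
  then have "|UNIV :: (nat \<Rightarrow> nat) set| \<le>o |F|"
    by (rule ordLeq_transitive[OF nat_seq_card_le_bool_seq])
  then show ?thesis
    using that[of UNIV] by blast
next
  case False
  \<comment> \<open>Meaningful only when these sets are finite, as for members of color 1; other
    members may yield arbitrary functions in the family.\<close>
  define h where "h H n = Max {g n |g e. strict_mono g \<and> sparse_code g e \<in> H}" for H :: "(nat \<Rightarrow> nat) set" and n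
  show ?thesis
  proof (rule that[of "h ` F"])
    show "|h ` F| \<le>o |F|"
      by (rule card_of_image)
    fix f :: "nat \<Rightarrow> nat"
    \<comment> \<open>A strictly increasing majorant of \<open>f\<close>, as sparse codes
      require.\<close>
    define g where "g n = (\<Sum>i\<le>n. f i) + n" for n
    have g: "strict_mono g"
      by (rule strict_monoI_Suc) (simp add: g_def)
    have fg: "f n \<le> g n" for n
      by (simp add: g_def trans_le_add1 member_le_sum)
    have "\<forall>e. \<exists>H\<in>F. sparse_code g e \<in> H"
      using homogeneous_cover_mem[OF F] by (simp add: sparse_code_def interleave_in_cantor_space)
    then obtain k where k: "\<And>e. k e \<in> F \<and> sparse_code g e \<in> k e"
      by metis
    have "\<not> inj k"
    proof
      assume "inj k"
      then have "|UNIV :: (nat \<Rightarrow> bool) set| \<le>o |F|"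
        by (rule card_of_ordLeqI) (use k in simp)
      then show False
        using False by blast
    qed
    then obtain e e' where e: "k e = k e'" "e \<noteq> e'"
      by (auto simp: inj_on_def)
    have "k e \<in> F"
      using k by blast
    with F obtain i where i [rule_format]: "\<forall>u\<in>k e. \<forall>v\<in>k e. u \<noteq> v \<longrightarrow> c_min {u, v} = i"
      by (rule homogeneous_coverE)
    have "inj g"
      using g strict_mono_imp_inj_on by blast
    then have "c_min {sparse_code g e, sparse_code g e'} = 1" "sparse_code g e \<noteq> sparse_code g e'"
      using c_min_sparse_code_same e(2) sparse_code_inj by blast+
    then have "i = 1"
      using i k[of e] k[of e'] e(1) by metis
    then have fin: "finite {g n |g e'. strict_mono g \<and> sparse_code g e' \<in> k e}" for n
      using i by (intro finite_sparse_code_values) auto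
    have "g n \<le> h (k e) n" for n
      unfolding h_def by (rule Max_ge[OF fin]) (use g k[of e] in blast)
    then show "\<exists>h\<in>h ` F. \<forall>n. f n \<le> h n"
      using k[of e] fg order_trans by blast
  qed
qed

section \<open>Universality of the random graph coloring\<close>

text \<open>Greedy construction: the extension property, applied to the images of the neighbours and
  of the non-neighbours of \<open>n\<close> below \<open>n\<close>, supplies the image of
  \<open>n\<close>.\<close>

lemma random_graph_embeds_countable_graph:
  assumes adj: "random_graph adj" and g: "\<And>p. g p \<in> {0, 1 :: nat}"
  obtains v :: "nat \<Rightarrow> nat" where "inj v" "\<And>i j. i \<noteq> j \<Longrightarrow> adj {v i, v j} = g {i, j}"
proof -
  define P where "P f n r \<longleftrightarrow> r \<notin> f ` {..<n} \<and> (\<forall>i<n. adj {r, f i} = g {n, i})"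
    for f :: "nat \<Rightarrow> nat" and n r :: nat
  have "\<exists>v. \<forall>n. P v n (v n)"
  proof (rule dependent_wellorder_choice)
    fix r :: nat and f f' :: "nat \<Rightarrow> nat" and n :: nat
    assume "\<And>y. y < n \<Longrightarrow> f y = f' y"
    then show "P f n r = P f' n r"
      unfolding P_def by (auto simp: image_iff)
  next
    fix n and f :: "nat \<Rightarrow> nat"
    assume IH: "\<And>y. y < n \<Longrightarrow> P f y (f y)"
    have inj: "f i \<noteq> f j" if "i < n" "j < n" "i \<noteq> j" for i j
    proof (rule linorder_cases[of i j])
      assume "i < j"
      then show ?thesis
        using IH[OF that(2)] unfolding P_def by (metis imageI lessThan_iff)
    next
      assume "j < i"
      then show ?thesis
        using IH[OF that(1)] unfolding P_def by (metis imageI lessThan_iff)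
    qed (use that in auto)
    let ?A = "f ` {i. i < n \<and> g {n, i} = 1}" and ?B = "f ` {i. i < n \<and> g {n, i} = 0}"
    have "finite ?A \<and> finite ?B \<and> ?A \<inter> ?B = {}"
    proof (intro conjI)
      show "?A \<inter> ?B = {}"
      proof (rule ccontr)
        assume "?A \<inter> ?B \<noteq> {}"
        then obtain i j where "i < n" "j < n" "g {n, i} = 1" "g {n, j} = 0" "f i = f j"
          by (auto simp: disjoint_iff)
        then show False
          using inj[of i j] by (cases "i = j") auto
      qed
    qed auto
    then obtain r where r: "r \<notin> ?A \<union> ?B" "\<forall>a\<in>?A. adj {r, a} = 1" "\<forall>b\<in>?B. adj {r, b} = 0"
      using adj unfolding random_graph_def by meson
    have "adj {r, f i} = g {n, i} \<and> r \<noteq> f i" if "i < n" for i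
    proof (cases "g {n, i} = 1")
      case True
      then have "f i \<in> ?A"
        using that by blast
      then show ?thesis
        using r(1,2) True by auto
    next
      case False
      then have "g {n, i} = 0"
        using g[of "{n, i}"] by auto
      moreover from this have "f i \<in> ?B"
        using that by blast
      ultimately show ?thesis
        using r(1,3) by auto
    qed
    then show "\<exists>r. P f n r"
      unfolding P_def by (intro exI[of _ r]) auto
  qed
  then obtain v where v: "\<And>n. P v n (v n)"
    by blast
  have lt: "adj {v j, v i} = g {j, i} \<and> v j \<noteq> v i" if "i < j" for i j
    using v[of j] that unfolding P_def by auto
  show ?thesis
  proof (rule that[of v])
    show "inj v"
      using lt by (metis injI linorder_neqE_nat)
    show "adj {v i, v j} = g {i, j}" if "i \<noteq> j" for i j
      using lt[of i j] lt[of j i] that by (cases "i < j") (auto simp: insert_commute)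
  qed
qed

text \<open>The vertex coding the \<open>n\<close>-th part of a point is written at a coordinate \<open>J n\<close> large enough for
  \<^const>\<open>max_space\<close>; all other coordinates are \<open>0\<close>.\<close>

lemma hm_le_c_max:
  fixes p :: "nat \<Rightarrow> 'x \<Rightarrow> nat"
  assumes adj: "random_graph adj"
    and fin: "\<And>n. finite (p n ` K)"
    and sep: "\<And>x y. x \<in> K \<Longrightarrow> y \<in> K \<Longrightarrow> x \<noteq> y \<Longrightarrow> \<exists>n. p n x \<noteq> p n y"
    and e: "\<And>x y. x \<in> K \<Longrightarrow> y \<in> K \<Longrightarrow> x \<noteq> y \<Longrightarrow> e {x, y} \<in> {0, 1}"
    and det: "\<And>n x y x' y'. x \<in> K \<Longrightarrow> y \<in> K \<Longrightarrow> x' \<in> K \<Longrightarrow> y' \<in> K \<Longrightarrow>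
      \<forall>m<n. p m x = p m y \<Longrightarrow> \<forall>m<n. p m x' = p m y' \<Longrightarrow> p n x \<noteq> p n y \<Longrightarrow>
      p n x' = p n x \<Longrightarrow> p n y' = p n y \<Longrightarrow> e {x, y} = e {x', y'}"
  shows "hm K e \<le>o hm max_space (c_max adj)"
proof -
  define Q where "Q n S x y \<longleftrightarrow> x \<in> K \<and> y \<in> K \<and> (\<forall>m<n. p m x = p m y) \<and> p n x \<noteq> p n y \<and> S = {p n x, p n y}"
    for n S x y
  \<comment> \<open>The graph of level \<open>n\<close> on the values of \<open>p n\<close>. By
    \<open>det\<close> the choice of the pair is immaterial; 0 is the color of value pairs at which
    no pair splits.\<close>
  define g where "g n S = (if \<exists>x y. Q n S x y then e (SOME s. \<exists>x y. Q n S x y \<and> s = {x, y}) else 0)"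
    for n S
  have g_eq: "g n {p n x, p n y} = e {x, y}" if Q: "Q n {p n x, p n y} x y" for n x y
  proof -
    let ?S = "{p n x, p n y}"
    have "\<exists>x' y'. Q n ?S x' y' \<and> (SOME s. \<exists>x y. Q n ?S x y \<and> s = {x, y}) = {x', y'}"
      by (rule someI[of "\<lambda>s. \<exists>x y. Q n ?S x y \<and> s = {x, y}" "{x, y}"]) (use Q in blast)
    then obtain x' y' where Q': "Q n ?S x' y'" and s: "(SOME s. \<exists>x y. Q n ?S x y \<and> s = {x, y}) = {x', y'}"
      by blast
    have "g n ?S = e {x', y'}"
      using Q s unfolding g_def by auto
    also have "\<dots> = e {x, y}"
    proof -
      \<comment> \<open>The chosen pair may match the given one crosswise, hence the equations in
        both directions.\<close>
      have q: "x \<in> K" "y \<in> K" "\<forall>m<n. p m x = p m y" "p n x \<noteq> p n y"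
        and q': "x' \<in> K" "y' \<in> K" "\<forall>m<n. p m x' = p m y'" "\<forall>m<n. p m y' = p m x'"
        using Q Q' unfolding Q_def by metis+
      show ?thesis
      proof (cases "p n x' = p n x")
        case True
        then have "p n y' = p n y"
          using Q' by (auto simp: Q_def doubleton_eq_iff)
        then show ?thesis
          using det[OF q(1,2) q'(1,2) q(3) q'(3) q(4) True] by simp
      next
        case False
        then have "p n x' = p n y" "p n y' = p n x"
          using Q' by (auto simp: Q_def doubleton_eq_iff)
        then have "e {x, y} = e {y', x'}"
          by (intro det[OF q(1,2) q'(2,1) q(3) q'(4) q(4)])
        then show ?thesis
          by (simp add: insert_commute)
      qed
    qed
    finally show ?thesis .
  qed
  have g01: "g n S \<in> {0, 1}" for n S
  proof (cases "\<exists>x y. Q n S x y")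
    case True
    then obtain x y where "Q n S x y"
      by blast
    then have "g n S = e {x, y}" "x \<noteq> y" "x \<in> K" "y \<in> K"
      using g_eq[of n x y] unfolding Q_def by auto
    then show ?thesis
      using e by metis
  qed (simp add: g_def)
  have "\<forall>n. \<exists>v. inj v \<and> (\<forall>i j. i \<noteq> j \<longrightarrow> adj {v i, v j} = g n {i, j})"
  proof
    fix n
    obtain v where "inj v" "\<And>i j. i \<noteq> j \<Longrightarrow> adj {v i, v j} = g n {i, j}"
      using random_graph_embeds_countable_graph[of adj "g n", OF adj g01] by blast
    then show "\<exists>v. inj v \<and> (\<forall>i j. i \<noteq> j \<longrightarrow> adj {v i, v j} = g n {i, j})"
      by blast
  qed
  then obtain v where inj: "\<And>n. inj (v n)" and v: "\<And>n i j. i \<noteq> j \<Longrightarrow> adj {v n i, v n j} = g n {i, j}"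
    by metis
  define b where "b n = Max (insert 0 (v n ` p n ` K))" for n
  have b: "v n (p n x) \<le> b n" if "x \<in> K" for n x
    unfolding b_def using that fin by (intro Max_ge) auto
  \<comment> \<open>The partial sums give \<open>b n \<le> J n\<close>, so a vertex of level
    \<open>n\<close> fits into coordinate \<open>J n\<close>; the summand \<open>n\<close> makes
    \<open>J\<close> strictly increasing.\<close>
  define J where "J n = (\<Sum>i\<le>n. b i) + n" for n
  have J: "strict_mono J"
    by (rule strict_monoI_Suc) (simp add: J_def)
  have bJ: "b n \<le> J n" for n
    by (simp add: J_def trans_le_add1 member_le_sum)
  define \<phi> where "\<phi> x j = (if j \<in> range J then v (inv J j) (p (inv J j) x) else 0)" for x j
  have \<phi>_J: "\<phi> x (J n) = v n (p n x)" for x n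
    using strict_mono_imp_inj_on[OF J] by (simp add: \<phi>_def)
  have \<phi>_0: "\<phi> x j = 0" if "j \<notin> range J" for x j
    using that by (simp add: \<phi>_def)
  have main: "\<phi> x \<noteq> \<phi> y \<and> c_max adj {\<phi> x, \<phi> y} = e {x, y}" if xy: "x \<in> K" "y \<in> K" "x \<noteq> y" for x y
  proof -
    define n where "n = (LEAST n. p n x \<noteq> p n y)"
    have n: "p n x \<noteq> p n y"
      unfolding n_def by (rule LeastI_ex) (rule sep[OF xy])
    have less: "p m x = p m y" if "m < n" for m
      using that not_less_Least unfolding n_def by blast
    have neq: "\<phi> x (J n) \<noteq> \<phi> y (J n)"
      using n inj[of n] by (auto simp: \<phi>_J dest: injD)
    have "Delta (\<phi> x) (\<phi> y) = J n"
    proof (rule Delta_eqI[where x = "\<phi> x" and y = "\<phi> y", OF neq])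
      fix j assume j: "j < J n"
      show "\<phi> x j = \<phi> y j"
      proof (cases "j \<in> range J")
        case True
        then obtain m where m: "j = J m"
          by blast
        then have "m < n"
          using j J by (simp add: strict_mono_less)
        then show ?thesis
          by (simp add: m \<phi>_J less)
      qed (simp add: \<phi>_0)
    qed
    then have "c_max adj {\<phi> x, \<phi> y} = g n {p n x, p n y}"
      using v[OF n] by (simp add: c_max_doubleton \<phi>_J)
    also have "\<dots> = e {x, y}"
      using xy n less by (intro g_eq) (simp add: Q_def)
    finally show ?thesis
      using neq by auto
  qed
  show ?thesis
  proof (rule hm_mono_embedding)
    fix x assume x: "x \<in> K"
    have "\<phi> x j < j + 1" for j
    proof (cases "j \<in> range J")
      case True
      then obtain n where "j = J n"
        by blast
      then show ?thesis
        using b[OF x, of n] bJ[of n] by (simp add: \<phi>_J)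
    qed (simp add: \<phi>_0)
    then show "\<phi> x \<in> max_space"
      by (simp add: max_space_def PiE_iff)
  next
    show "inj_on \<phi> K"
      using main by (meson inj_onI)
  qed (use main in blast)
qed

text \<open>The coordinates serve as parts, since the parity color depends on the splitting level
  alone. This makes hm(c_max) infinite and at least the size of the dominating family.\<close>

lemma hm_c_min_le_c_max:
  assumes "random_graph adj"
  shows "hm cantor_space c_min \<le>o hm max_space (c_max adj)"
proof (rule hm_le_c_max[where p = "\<lambda>n x. x n", OF assms])
  show "finite ((\<lambda>x. x n) ` cantor_space)" for n
    by (rule finite_subset[of _ "{0, 1}"]) (force simp: cantor_space_def PiE_iff)+
next
  fix n and x y x' y' :: "nat \<Rightarrow> nat"
  assume eq: "\<forall>m<n. x m = y m" "\<forall>m<n. x' m = y' m" "x n \<noteq> y n" "x' n = x n" "y' n = y n"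
  then have "Delta x y = n" "Delta x' y' = n"
    by (auto intro!: Delta_eqI)
  then show "c_min {x, y} = c_min {x', y'}"
    by (simp add: c_min_doubleton)
qed (auto simp: c_min_def)

section \<open>Colorings determined by clopen bits\<close>

text \<open>The colors \<open>0\<close> and \<open>1\<close> that \<open>e0\<close> and \<open>e1\<close> give to bad pairs differ, so a set homogeneous for both
  consists of good pairs only or of bad pairs only.\<close>

lemma homogeneous_of_three:
  assumes h: "homogeneous e0 H" "homogeneous e1 H" "homogeneous e2 H"
    and good: "\<And>x y. x \<in> H \<Longrightarrow> y \<in> H \<Longrightarrow> x \<noteq> y \<Longrightarrow> G {x, y} \<Longrightarrow> e0 {x, y} = c {x, y} \<and> e1 {x, y} = c {x, y}"
    and bad: "\<And>x y. x \<in> H \<Longrightarrow> y \<in> H \<Longrightarrow> x \<noteq> y \<Longrightarrow> \<not> G {x, y} \<Longrightarrow>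
      e0 {x, y} = 0 \<and> e1 {x, y} = 1 \<and> e2 {x, y} = c {x, y}"
  shows "homogeneous c H"
proof -
  obtain i0 where i0: "\<forall>x\<in>H. \<forall>y\<in>H. x \<noteq> y \<longrightarrow> e0 {x, y} = i0"
    using h(1) unfolding homogeneous_iff by blast
  obtain i1 where i1: "\<forall>x\<in>H. \<forall>y\<in>H. x \<noteq> y \<longrightarrow> e1 {x, y} = i1"
    using h(2) unfolding homogeneous_iff by blast
  obtain i2 where i2: "\<forall>x\<in>H. \<forall>y\<in>H. x \<noteq> y \<longrightarrow> e2 {x, y} = i2"
    using h(3) unfolding homogeneous_iff by blast
  consider "i0 \<noteq> 0" | "i1 \<noteq> 1" | "i0 = 0" "i1 = 1"
    by blast
  then show ?thesis
  proof cases
    case 1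
    have "c {x, y} = i0" if "x \<in> H" "y \<in> H" "x \<noteq> y" for x y
      using i0 that good[OF that] bad[OF that] 1 by (cases "G {x, y}") auto
    then show ?thesis
      unfolding homogeneous_iff by blast
  next
    case 2
    have "c {x, y} = i1" if "x \<in> H" "y \<in> H" "x \<noteq> y" for x y
      using i1 that good[OF that] bad[OF that] 2 by (cases "G {x, y}") auto
    then show ?thesis
      unfolding homogeneous_iff by blast
  next
    case 3
    have "c {x, y} = i2" if "x \<in> H" "y \<in> H" "x \<noteq> y" for x y
      using i0 i1 i2 that good[OF that] bad[OF that] 3 by (cases "G {x, y}") auto
    then show ?thesis
      unfolding homogeneous_iff by blast
  qed
qed

lemma homogeneous_subset: "homogeneous c H \<Longrightarrow> H' \<subseteq> H \<Longrightarrow> homogeneous c H'"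
  unfolding homogeneous_def using nsets_mono by (meson subsetD)

text \<open>Intersections of members of the three covers are homogeneous for \<open>c\<close>, and
  \<open>F\<close> absorbs the triple product.\<close>

lemma hm_le_of_three:
  assumes inf: "infinite F" and le: "hm K e0 \<le>o |F|" "hm K e1 \<le>o |F|" "hm K e2 \<le>o |F|"
    and good: "\<And>x y. x \<in> K \<Longrightarrow> y \<in> K \<Longrightarrow> x \<noteq> y \<Longrightarrow> G {x, y} \<Longrightarrow> e0 {x, y} = c {x, y} \<and> e1 {x, y} = c {x, y}"
    and bad: "\<And>x y. x \<in> K \<Longrightarrow> y \<in> K \<Longrightarrow> x \<noteq> y \<Longrightarrow> \<not> G {x, y} \<Longrightarrow>
      e0 {x, y} = 0 \<and> e1 {x, y} = 1 \<and> e2 {x, y} = c {x, y}"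
  shows "hm K c \<le>o |F|"
proof -
  obtain F0 where F0: "homogeneous_cover K e0 F0" "hm K e0 = |F0|"
    by (rule hm_cover)
  obtain F1 where F1: "homogeneous_cover K e1 F1" "hm K e1 = |F1|"
    by (rule hm_cover)
  obtain F2 where F2: "homogeneous_cover K e2 F2" "hm K e2 = |F2|"
    by (rule hm_cover)
  have "hm K c \<le>o |F0 \<times> F1 \<times> F2|"
  proof (rule hm_leI[where H = "\<lambda>(A, B, C). A \<inter> B \<inter> C"])
    fix x assume x: "x \<in> K"
    obtain A B C where "A \<in> F0" "B \<in> F1" "C \<in> F2" "x \<in> A" "x \<in> B" "x \<in> C"
      using homogeneous_cover_mem[OF F0(1) x] homogeneous_cover_mem[OF F1(1) x]
        homogeneous_cover_mem[OF F2(1) x] by blast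
    then show "\<exists>a\<in>F0 \<times> F1 \<times> F2. x \<in> (case a of (A, B, C) \<Rightarrow> A \<inter> B \<inter> C)"
      by (intro bexI[of _ "(A, B, C)"]) auto
  next
    fix a assume "a \<in> F0 \<times> F1 \<times> F2"
    then obtain A B C where a: "a = (A, B, C)" and m: "A \<in> F0" "B \<in> F1" "C \<in> F2"
      by (cases a) auto
    have hom: "homogeneous e0 A" "homogeneous e1 B" "homogeneous e2 C"
      using F0(1) F1(1) F2(1) m by (auto simp: homogeneous_cover_def)
    have "homogeneous c (A \<inter> B \<inter> C \<inter> K)"
    proof (rule homogeneous_of_three[where G = G])
      show "homogeneous e0 (A \<inter> B \<inter> C \<inter> K)" "homogeneous e1 (A \<inter> B \<inter> C \<inter> K)"
        "homogeneous e2 (A \<inter> B \<inter> C \<inter> K)"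
        using hom by (auto elim!: homogeneous_subset)
    qed (use good bad in auto)
    then show "homogeneous c ((case a of (A, B, C) \<Rightarrow> A \<inter> B \<inter> C) \<inter> K)"
      by (simp add: a)
  qed
  also have "|F0 \<times> F1 \<times> F2| \<le>o |F|"
    using inf le F0(2) F1(2) F2(2) by (simp add: card_of_Sigma_ordLeq_infinite)
  finally show ?thesis .
qed

text \<open>A node of level \<open>L\<close> in the binary tree of bits, as a number because parts
  in \<open>hm_le_c_max\<close> are numbers.\<close>

definition bit_code :: "(nat \<Rightarrow> 'a \<Rightarrow> bool) \<Rightarrow> nat \<Rightarrow> 'a \<Rightarrow> nat" where
  "bit_code b L x = set_encode {i. i < L \<and> b i x}"

lemma bit_code_eq_iff: "bit_code b L x = bit_code b L y \<longleftrightarrow> (\<forall>i<L. b i x = b i y)"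
proof -
  have "bit_code b L x = bit_code b L y \<longleftrightarrow> {i. i < L \<and> b i x} = {i. i < L \<and> b i y}"
    unfolding bit_code_def by (rule set_encode_eq) auto
  then show ?thesis
    by blast
qed

lemma finite_bit_code: "finite (bit_code b L ` K)"
proof -
  have "bit_code b L ` K \<subseteq> set_encode ` Pow {..<L}"
    unfolding bit_code_def by auto
  then show ?thesis
    by (rule finite_subset) simp
qed

text \<open>The color of a pair splitting below \<open>N\<close> may depend on bits beyond \<open>N\<close>. Passing to levels \<open>L\<close> with \<open>L (n + 1)\<close> sufficient for pairs splitting below \<open>L n\<close>, the even and
  the odd levels give two trees, and each pair is decided at its splitting level in one of them.\<close>

lemma hm_le_c_max_of_bits:
  fixes b :: "nat \<Rightarrow> 'a \<Rightarrow> bool"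
  assumes adj: "random_graph adj"
    and sep: "\<And>x y. x \<in> K \<Longrightarrow> y \<in> K \<Longrightarrow> x \<noteq> y \<Longrightarrow> \<exists>i. b i x \<noteq> b i y"
    and c01: "\<And>x y. x \<in> K \<Longrightarrow> y \<in> K \<Longrightarrow> x \<noteq> y \<Longrightarrow> c {x, y} \<in> {0, 1}"
    and det: "\<And>N. \<exists>m. \<forall>x\<in>K. \<forall>y\<in>K. \<forall>x'\<in>K. \<forall>y'\<in>K. (\<exists>i<N. b i x \<noteq> b i y) \<longrightarrow>
      (\<forall>i<m. b i x = b i x') \<longrightarrow> (\<forall>i<m. b i y = b i y') \<longrightarrow> c {x, y} = c {x', y'}"
    and inf: "infinite F" and F: "hm max_space (c_max adj) = |F|"
  shows "hm K c \<le>o |F|"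
proof -
  define R where "R N m \<longleftrightarrow> (\<forall>x\<in>K. \<forall>y\<in>K. \<forall>x'\<in>K. \<forall>y'\<in>K. (\<exists>i<N. b i x \<noteq> b i y) \<longrightarrow>
      (\<forall>i<m. b i x = b i x') \<longrightarrow> (\<forall>i<m. b i y = b i y') \<longrightarrow> c {x, y} = c {x', y'})" for N m
  have "\<forall>N. \<exists>m. R N m"
    using det unfolding R_def by (rule allI)
  then obtain m where R: "\<forall>N. R N (m N)"
    by metis
  have m: "c {x, y} = c {x', y'}"
    if "x \<in> K" "y \<in> K" "x' \<in> K" "y' \<in> K" "\<exists>i<N. b i x \<noteq> b i y"
      "\<forall>i<m N. b i x = b i x'" "\<forall>i<m N. b i y = b i y'" for N x y x' y'
    by (rule spec[OF R, of N, unfolded R_def, THEN bspec, OF that(1), THEN bspec, OF that(2),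
      THEN bspec, OF that(3), THEN bspec, OF that(4), THEN mp, OF that(5), THEN mp, OF that(6),
      THEN mp, OF that(7)])
  define L where "L = rec_nat 0 (\<lambda>_ l. max (Suc l) (m l))"
  have L0: "L 0 = 0" and LSuc: "L (Suc n) = max (Suc (L n)) (m (L n))" for n
    by (simp_all add: L_def)
  have Lmono: "strict_mono L"
    by (rule strict_monoI_Suc) (simp add: LSuc)
  have Lle: "L i \<le> L j" if "i \<le> j" for i j
    using that Lmono by (simp add: strict_mono_less_eq)
  have color: "c {x, y} = c {x', y'}"
    if "x \<in> K" "y \<in> K" "x' \<in> K" "y' \<in> K" "bit_code b (L n) x \<noteq> bit_code b (L n) y"
      "bit_code b (L (Suc n)) x' = bit_code b (L (Suc n)) x" "bit_code b (L (Suc n)) y' = bit_code b (L (Suc n)) y"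
    for n x y x' y'
    using that(5-7) by (intro m[OF that(1-4), of "L n"]) (auto simp: bit_code_eq_iff LSuc)
  have coarse: "bit_code b (L i) x = bit_code b (L i) y"
    if "bit_code b (L j) x = bit_code b (L j) y" "i \<le> j" for i j x y
    using that(1) Lle[OF that(2)] by (auto simp: bit_code_eq_iff)
  define lev where "lev s = (LEAST n. \<exists>x\<in>s. \<exists>y\<in>s. bit_code b (L n) x \<noteq> bit_code b (L n) y)" for s
  have lev_eqI: "lev {x, y} = n" if "bit_code b (L n) x \<noteq> bit_code b (L n) y"
    "\<And>k. k < n \<Longrightarrow> bit_code b (L k) x = bit_code b (L k) y" for x y n
    unfolding lev_def by (rule Least_equality) (use that in \<open>force simp: not_less[symmetric]\<close>)+
  have sepL: "\<exists>n. bit_code b (L n) x \<noteq> bit_code b (L n) y" if xy: "x \<in> K" "y \<in> K" "x \<noteq> y" for x y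
  proof -
    obtain i where i: "b i x \<noteq> b i y"
      using sep[OF xy] by blast
    have "i < L (Suc i)"
      using strict_mono_imp_increasing[OF Lmono, of "Suc i"] by simp
    then show ?thesis
      using i unfolding bit_code_eq_iff by blast
  qed
  have lev: "bit_code b (L (lev {x, y})) x \<noteq> bit_code b (L (lev {x, y})) y"
    and lev_less: "\<And>k. k < lev {x, y} \<Longrightarrow> bit_code b (L k) x = bit_code b (L k) y"
    if xy: "x \<in> K" "y \<in> K" "x \<noteq> y" for x y
  proof -
    define n where "n = (LEAST n. bit_code b (L n) x \<noteq> bit_code b (L n) y)"
    have n: "bit_code b (L n) x \<noteq> bit_code b (L n) y"
      unfolding n_def by (rule LeastI_ex) (rule sepL[OF xy])
    have less: "bit_code b (L k) x = bit_code b (L k) y" if "k < n" for k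
      using that not_less_Least unfolding n_def by blast
    have "lev {x, y} = n"
      using n less by (rule lev_eqI)
    then show "bit_code b (L (lev {x, y})) x \<noteq> bit_code b (L (lev {x, y})) y"
      "\<And>k. k < lev {x, y} \<Longrightarrow> bit_code b (L k) x = bit_code b (L k) y"
      using n less by simp_all
  qed
  \<comment> \<open>\<open>M\<close> thins the levels. A splitting index \<open>k\<close> with
    \<open>P k\<close> in the block ending at \<open>M n\<close> is strictly below
    \<open>M n\<close>, so the nodes of level \<open>L (M n)\<close> extend those of level
    \<open>L (Suc k)\<close>, which fix the color.\<close>
  have decided: "hm K (\<lambda>s. if P (lev s) then c s else j) \<le>o |F|"
    if j: "j \<in> {0, 1}" and M: "strict_mono M"
      and P: "\<And>n k. k \<le> M n \<Longrightarrow> (\<And>n'. n' < n \<Longrightarrow> M n' < k) \<Longrightarrow> P k \<Longrightarrow> k < M n"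
    for j :: nat and M :: "nat \<Rightarrow> nat" and P
    unfolding F[symmetric]
  proof (rule hm_le_c_max[where p = "\<lambda>n. bit_code b (L (M n))", OF adj finite_bit_code])
    fix x y assume xy: "x \<in> K" "y \<in> K" "x \<noteq> y"
    then obtain n where "bit_code b (L n) x \<noteq> bit_code b (L n) y"
      using sepL by blast
    then have "bit_code b (L (M n)) x \<noteq> bit_code b (L (M n)) y"
      using coarse strict_mono_imp_increasing[OF M, of n] by blast
    then show "\<exists>n. bit_code b (L (M n)) x \<noteq> bit_code b (L (M n)) y"
      by blast
    show "(if P (lev {x, y}) then c {x, y} else j) \<in> {0, 1}"
      using c01[OF xy] j by simp
  next
    fix n x y x' y'
    assume K: "x \<in> K" "y \<in> K" "x' \<in> K" "y' \<in> K"
      and low: "\<forall>k<n. bit_code b (L (M k)) x = bit_code b (L (M k)) y"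
      "\<forall>k<n. bit_code b (L (M k)) x' = bit_code b (L (M k)) y'"
      and neq: "bit_code b (L (M n)) x \<noteq> bit_code b (L (M n)) y"
      and eq: "bit_code b (L (M n)) x' = bit_code b (L (M n)) x" "bit_code b (L (M n)) y' = bit_code b (L (M n)) y"
    have xy: "x \<noteq> y"
      using neq by blast
    note l = lev[OF K(1,2) xy] lev_less[OF K(1,2) xy]
    have le: "lev {x, y} \<le> M n"
      using l(2) neq by (meson not_less)
    have gt: "M n' < lev {x, y}" if "n' < n" for n'
      using low(1) that l(1) coarse by (meson not_less)
    have eq': "bit_code b (L k) x' = bit_code b (L k) x" "bit_code b (L k) y' = bit_code b (L k) y" if "k \<le> M n" for k
      using eq that by (blast intro: coarse)+
    have "lev {x', y'} = lev {x, y}"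
    proof (rule lev_eqI)
      show "bit_code b (L (lev {x, y})) x' \<noteq> bit_code b (L (lev {x, y})) y'"
        using l(1) eq'[OF le] by simp
      show "bit_code b (L k) x' = bit_code b (L k) y'" if "k < lev {x, y}" for k
        using l(2)[OF that] eq'[of k] that le by simp
    qed
    moreover have "c {x, y} = c {x', y'}" if "P (lev {x, y})"
    proof -
      have "lev {x, y} < M n"
        using le gt that by (rule P)
      then show ?thesis
        using eq'[of "Suc (lev {x, y})"] by (intro color[OF K l(1)]) simp_all
    qed
    ultimately show "(if P (lev {x, y}) then c {x, y} else j) = (if P (lev {x', y'}) then c {x', y'} else j)"
      by simp
  qed
  \<comment> \<open>Blocks ending at even indices decide the odd splitting levels, blocks ending at
    odd indices the even ones.\<close>
  have M2: "strict_mono (\<lambda>n. 2 * n :: nat)" "strict_mono (\<lambda>n. Suc (2 * n))"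
    by (simp_all add: strict_mono_def)
  have even_lt: "k < 2 * n" if "k \<le> 2 * n" "odd k" for k n :: nat
    using that by (metis dvd_triv_left le_neq_implies_less)
  have odd_lt: "k < Suc (2 * n)" if "k \<le> Suc (2 * n)" "\<not> odd k" for k n :: nat
    using that by (metis even_Suc dvd_triv_left le_neq_implies_less)
  show ?thesis
  proof (rule hm_le_of_three[where G = "\<lambda>s. odd (lev s)", OF inf])
    show "hm K (\<lambda>s. if odd (lev s) then c s else 0) \<le>o |F|"
      by (rule decided[OF _ M2(1)]) (use even_lt in auto)
    show "hm K (\<lambda>s. if odd (lev s) then c s else 1) \<le>o |F|"
      by (rule decided[OF _ M2(1)]) (use even_lt in auto)
    show "hm K (\<lambda>s. if \<not> odd (lev s) then c s else 0) \<le>o |F|"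
      by (rule decided[OF _ M2(2)]) (use odd_lt in auto)
  qed auto
qed

section \<open>Continuous colorings of complete metric spaces\<close>

lemma continuous_coloring_01:
  "continuous_coloring X c \<Longrightarrow> x \<in> topspace X \<Longrightarrow> y \<in> topspace X \<Longrightarrow> x \<noteq> y \<Longrightarrow> c {x, y} \<in> {0, 1}"
  unfolding continuous_coloring_def by (auto simp: Pi_iff)

text \<open>A box inside an open set of the product may still meet the diagonal; cutting it with
  disjoint neighbourhoods removes this.\<close>

lemma continuous_coloring_neighbourhoods:
  assumes X: "Hausdorff_space X" and c: "continuous_coloring X c"
    and xy: "x \<in> topspace X" "y \<in> topspace X" "x \<noteq> y"
  obtains U V where "openin X U" "openin X V" "x \<in> U" "y \<in> V" "disjnt U V"
    "\<forall>u\<in>U. \<forall>v\<in>V. c {u, v} = c {x, y}"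
proof -
  define W where "W = {p \<in> [topspace X]\<^bsup>2\<^esup>. c p = c {x, y}}"
  have "openin (pair_topology X) W"
    using c continuous_coloring_01[OF c xy] unfolding continuous_coloring_def W_def by blast
  then have "openin (off_diagonal X) {z \<in> topspace (off_diagonal X). {fst z, snd z} \<in> W}"
    by (simp add: openin_pair_topology)
  then obtain T where T: "openin (prod_topology X X) T"
    and eq: "{z \<in> topspace (off_diagonal X). {fst z, snd z} \<in> W} = T \<inter> {(x, y). x \<noteq> y}"
    unfolding off_diagonal_def openin_subtopology by blast
  have "(x, y) \<in> {z \<in> topspace (off_diagonal X). {fst z, snd z} \<in> W}"
    using xy by (auto simp: topspace_off_diagonal W_def)
  then have xyT: "(x, y) \<in> T"
    unfolding eq by blast
  obtain A B where AB: "openin X A" "openin X B" "x \<in> A" "y \<in> B" "A \<times> B \<subseteq> T"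
    using T[unfolded openin_prod_topology_alt, THEN spec, THEN spec, THEN mp, OF xyT] by (elim exE conjE)
  obtain U V where UV: "openin X U" "openin X V" "x \<in> U" "y \<in> V" "disjnt U V"
    using X[unfolded Hausdorff_space_def, rule_format, OF conjI[OF xy(1) conjI[OF xy(2,3)]]]
    by (elim exE conjE)
  show ?thesis
  proof (rule that[of "A \<inter> U" "B \<inter> V"])
    show "\<forall>u\<in>A \<inter> U. \<forall>v\<in>B \<inter> V. c {u, v} = c {x, y}"
    proof (intro ballI)
      fix u v assume uv: "u \<in> A \<inter> U" "v \<in> B \<inter> V"
      then have "(u, v) \<in> T \<inter> {(x, y). x \<noteq> y}"
        using AB(5) UV(5) by (auto simp: disjnt_iff)
      then have "{u, v} \<in> W"
        unfolding eq[symmetric] by simp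
      then show "c {u, v} = c {x, y}"
        by (simp add: W_def)
    qed
  qed (use AB UV in \<open>auto simp: disjnt_iff\<close>)
qed

section \<open>Cantor schemes for reduced colorings\<close>

context Metric_space
begin

text \<open>Both colors occur in \<open>U\<close>, which is not homogeneous. Continuity thickens a
  pair of color \<open>i\<close> to two open sets, and small balls keep the closures inside
  \<open>U\<close>.\<close>

lemma reduced_coloring_split:
  assumes c: "reduced_coloring mtopology c" and U: "openin mtopology U" "U \<noteq> {}"
    and i: "i \<in> {0, 1}" and e: "e > 0"
  obtains A B where "openin mtopology A" "openin mtopology B" "A \<noteq> {}" "B \<noteq> {}"
    "mtopology closure_of A \<subseteq> U" "mtopology closure_of B \<subseteq> U"
    "\<exists>a. mtopology closure_of A \<subseteq> mcball a e" "\<exists>b. mtopology closure_of B \<subseteq> mcball b e"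
    "\<forall>x\<in>A. \<forall>y\<in>B. x \<noteq> y \<and> c {x, y} = i"
proof -
  have cont: "continuous_coloring mtopology c" and "\<not> homogeneous c U"
    using c U unfolding reduced_coloring_def by auto
  have UM: "U \<subseteq> M"
    using U(1) openin_subset by fastforce
  have "\<exists>x\<in>U. \<exists>y\<in>U. x \<noteq> y \<and> c {x, y} = i"
  proof (rule ccontr)
    assume neg: "\<not> ?thesis"
    have "c {x, y} = 1 - i" if "x \<in> U" "y \<in> U" "x \<noteq> y" for x y
    proof -
      have "c {x, y} \<in> {0, 1}"
        using that UM by (intro continuous_coloring_01[OF cont]) auto
      then show ?thesis
        using neg that i by auto
    qed
    then have "homogeneous c U"
      unfolding homogeneous_iff by blast
    then show False
      using \<open>\<not> homogeneous c U\<close> by blast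
  qed
  then obtain x y where xy: "x \<in> U" "y \<in> U" "x \<noteq> y" "c {x, y} = i"
    by blast
  have mem: "x \<in> topspace mtopology" "y \<in> topspace mtopology"
    using xy UM by auto
  obtain P Q where PQ: "openin mtopology P" "openin mtopology Q" "x \<in> P" "y \<in> Q" "disjnt P Q"
    "\<forall>u\<in>P. \<forall>v\<in>Q. c {u, v} = c {x, y}"
    by (rule continuous_coloring_neighbourhoods[OF Hausdorff_space_mtopology cont mem xy(3)])
  have shrink: "\<exists>A. openin mtopology A \<and> A \<noteq> {} \<and> A \<subseteq> S \<and> mtopology closure_of A \<subseteq> U \<and>
      (\<exists>a. mtopology closure_of A \<subseteq> mcball a e)"
    if S: "openin mtopology S" "z \<in> S" "z \<in> U" for S z
  proof -
    have "openin mtopology (S \<inter> U)" "z \<in> S \<inter> U"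
      using S U by auto
    then obtain r where r: "r > 0" "mball z r \<subseteq> S \<inter> U" and z: "z \<in> M"
      unfolding openin_mtopology by blast
    let ?r = "min (r / 2) e"
    have "mtopology closure_of (mball z ?r) \<subseteq> mcball z ?r"
      by (intro closure_of_minimal) auto
    moreover have "mcball z ?r \<subseteq> mball z r" "mcball z ?r \<subseteq> mcball z e"
      using r by auto
    ultimately have "mtopology closure_of (mball z ?r) \<subseteq> U" "mtopology closure_of (mball z ?r) \<subseteq> mcball z e"
      using r by blast+
    moreover have "z \<in> mball z ?r" "mball z ?r \<subseteq> S"
      using z r e by auto
    ultimately show ?thesis
      by (intro exI[of _ "mball z ?r"]) blast
  qed
  obtain A where A: "openin mtopology A" "A \<noteq> {}" "A \<subseteq> P" "mtopology closure_of A \<subseteq> U"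
    "\<exists>a. mtopology closure_of A \<subseteq> mcball a e"
    using shrink[OF PQ(1,3) xy(1)] by blast
  obtain B where B: "openin mtopology B" "B \<noteq> {}" "B \<subseteq> Q" "mtopology closure_of B \<subseteq> U"
    "\<exists>a. mtopology closure_of B \<subseteq> mcball a e"
    using shrink[OF PQ(2,4) xy(2)] by blast
  show ?thesis
  proof (rule that[OF A(1) B(1) A(2) B(2) A(4) B(4) A(5) B(5)])
    show "\<forall>u\<in>A. \<forall>v\<in>B. u \<noteq> v \<and> c {u, v} = i"
      using PQ(5,6) A(3) B(3) xy(4) unfolding disjnt_iff by (metis subsetD)
  qed
qed

lemma hm_c_min_le_reduced:
  assumes mc: "mcomplete" and ne: "M \<noteq> {}" and c: "reduced_coloring mtopology c"
  shows "hm cantor_space c_min \<le>o hm M c"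
proof -
  define ok where "ok n U A \<longleftrightarrow> openin mtopology A \<and> A \<noteq> {} \<and> mtopology closure_of A \<subseteq> U \<and>
    (\<exists>a. mtopology closure_of A \<subseteq> mcball a (1 / Suc n))" for n :: nat and U A
  define split where "split n U p \<longleftrightarrow> ok n U (fst p) \<and> ok n U (snd p) \<and>
    (\<forall>x\<in>fst p. \<forall>y\<in>snd p. x \<noteq> y \<and> c {x, y} = n mod 2)" for n :: nat and U and p :: "'a set \<times> 'a set"
  define s where "s n U = (SOME p. split n U p)" for n U
  have s: "split n U (s n U)" if U: "openin mtopology U" "U \<noteq> {}" for n U
  proof -
    have "n mod 2 \<in> {0, 1}" "1 / Suc n > 0"
      by auto
    from reduced_coloring_split[OF c U this] obtain A B where
      "openin mtopology A" "openin mtopology B" "A \<noteq> {}" "B \<noteq> {}"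
      "mtopology closure_of A \<subseteq> U" "mtopology closure_of B \<subseteq> U"
      "\<exists>a. mtopology closure_of A \<subseteq> mcball a (1 / Suc n)" "\<exists>b. mtopology closure_of B \<subseteq> mcball b (1 / Suc n)"
      "\<forall>x\<in>A. \<forall>y\<in>B. x \<noteq> y \<and> c {x, y} = n mod 2" .
    then have "split n U (A, B)"
      by (simp add: split_def ok_def)
    then show ?thesis
      unfolding s_def by (rule someI)
  qed
  \<comment> \<open>\<open>V x n\<close> depends on \<open>x\<close> below \<open>n\<close> only,
    and its two halves form pairs of color \<open>n mod 2\<close>, the parity color of sequences
    splitting at \<open>n\<close>.\<close>
  define V where "V x = rec_nat M (\<lambda>n U. (if x n = 0 then fst else snd) (s n U))" for x :: "nat \<Rightarrow> nat"
  have V0: "V x 0 = M" and VSuc: "V x (Suc n) = (if x n = 0 then fst else snd) (s n (V x n))" for x n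
    by (simp_all add: V_def)
  have V: "openin mtopology (V x n) \<and> V x n \<noteq> {}" for x n
  proof (induction n)
    case 0
    show ?case
      using ne openin_topspace[of mtopology] by (simp add: V0)
  next
    case (Suc n)
    then have "split n (V x n) (s n (V x n))"
      using s by blast
    then show ?case
      by (simp add: VSuc split_def ok_def)
  qed
  have sV: "split n (V x n) (s n (V x n))" for x n
    using s V by blast
  have okV: "ok n (V x n) (V x (Suc n))" for x n
    using sV[of n x] by (simp add: VSuc split_def)
  have "\<exists>z. \<forall>n. z \<in> V x n" for x
  proof -
    define C where "C n = mtopology closure_of (V x (Suc n))" for n
    have CV: "C n \<subseteq> V x n" for n
      using okV[of n x] unfolding ok_def C_def by blast
    have sub: "V x (Suc n) \<subseteq> C n" for n
      unfolding C_def using V openin_subset by (metis closure_of_subset)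
    have "\<Inter> (range C) \<noteq> {}"
    proof (rule mcomplete_nest[THEN iffD1, OF mc, rule_format], intro conjI allI impI)
      show "closedin mtopology (C n)" for n
        by (simp add: C_def)
      show "C n \<noteq> {}" for n
        using sub[of n] V[of x "Suc n"] by blast
      show "decseq C"
        using CV sub by (intro decseq_SucI) blast
      fix e :: real assume "e > 0"
      then obtain n where n: "1 / Suc n < e"
        using nat_approx_posE by blast
      obtain a where a: "C n \<subseteq> mcball a (1 / Suc n)"
        using okV[of n x] unfolding ok_def C_def by blast
      also have "mcball a (1 / Suc n) \<subseteq> mcball a e"
        using n by (intro mcball_subset_concentric) simp
      finally show "\<exists>n a. C n \<subseteq> mcball a e"
        by blast
    qed
    then show ?thesis
      using CV by blast
  qed
  then obtain \<phi> where \<phi>: "\<And>x n. \<phi> x \<in> V x n"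
    by metis
  have main: "\<phi> x \<noteq> \<phi> y \<and> c {\<phi> x, \<phi> y} = c_min {x, y}"
    if xy: "x \<in> cantor_space" "y \<in> cantor_space" "x \<noteq> y" for x y
  proof -
    define n where "n = Delta x y"
    have V_eq: "V x k = V y k" if "k \<le> n" for k
      using that
    proof (induction k)
      case (Suc k)
      then have "x k = y k"
        unfolding n_def by (intro Delta_least) simp
      then show ?case
        using Suc by (simp add: VSuc)
    qed (simp add: V0)
    define p where "p = s n (V x n)"
    have p: "\<forall>u\<in>fst p. \<forall>v\<in>snd p. u \<noteq> v \<and> c {u, v} = n mod 2"
      using sV[of n x] unfolding p_def split_def by blast
    have mem: "\<phi> x \<in> (if x n = 0 then fst else snd) p" "\<phi> y \<in> (if y n = 0 then fst else snd) p"
      using \<phi>[of x "Suc n"] \<phi>[of y "Suc n"] V_eq[of n] by (simp_all add: VSuc p_def)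
    have "x n \<noteq> y n"
      unfolding n_def by (rule Delta_neq[OF xy(3)])
    moreover have "x n \<in> {0, 1}" "y n \<in> {0, 1}"
      using xy(1,2) by (auto simp: cantor_space_def PiE_iff)
    ultimately consider "x n = 0" "y n = 1" | "x n = 1" "y n = 0"
      by force
    then have "\<phi> x \<noteq> \<phi> y \<and> c {\<phi> x, \<phi> y} = n mod 2"
    proof cases
      case 1
      then show ?thesis
        using p mem by simp
    next
      case 2
      then have "\<phi> y \<noteq> \<phi> x \<and> c {\<phi> y, \<phi> x} = n mod 2"
        using p mem by simp
      then show ?thesis
        by (metis insert_commute)
    qed
    then show ?thesis
      by (simp add: c_min_doubleton n_def)
  qed
  show ?thesis
  proof (rule hm_mono_embedding)
    show "\<phi> x \<in> M" for x
      using \<phi>[of x 0] by (simp add: V0)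
    show "inj_on \<phi> cantor_space"
      using main by (meson inj_onI)
  qed (use main in blast)
qed

section \<open>Compact sets with separating clopen bits\<close>

lemma compactin_common_subsequence:
  assumes K: "compactin mtopology K" and st: "range \<sigma> \<subseteq> K" "range \<tau> \<subseteq> K"
  obtains r :: "nat \<Rightarrow> nat" and l m where "strict_mono r" "l \<in> K" "m \<in> K"
    "limitin mtopology (\<sigma> \<circ> r) l sequentially" "limitin mtopology (\<tau> \<circ> r) m sequentially"
proof -
  obtain l r where r: "l \<in> K" "strict_mono r" "limitin mtopology (\<sigma> \<circ> r) l sequentially"
    using K[unfolded compactin_sequentially, THEN conjunct2, rule_format, OF st(1)]
    by (elim exE conjE)
  have sub: "range (\<tau> \<circ> r) \<subseteq> K"
    using st(2) by auto
  obtain m q where q: "m \<in> K" "strict_mono q" "limitin mtopology ((\<tau> \<circ> r) \<circ> q) m sequentially"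
    using K[unfolded compactin_sequentially, THEN conjunct2, rule_format, OF sub] by (elim exE conjE)
  show ?thesis
  proof (rule that[of "r \<circ> q" l m])
    show "strict_mono (r \<circ> q)"
      using r q by (simp add: strict_mono_o)
    show "limitin mtopology (\<sigma> \<circ> (r \<circ> q)) l sequentially"
      using limitin_subsequence[OF q(2) r(3)] by (simp add: o_assoc)
  qed (use r q in \<open>simp_all add: o_assoc\<close>)
qed

text \<open>Otherwise counterexamples for all \<open>m\<close> have convergent subsequences. In the
  limit \<open>x\<close> and \<open>x'\<close> share all bits, hence coincide, and so do
  \<open>y\<close> and \<open>y'\<close>; but \<open>x\<close> and \<open>y\<close> stay apart
  because one of finitely many bits separates them. Continuity at the limit pair then contradicts
  the different colors.\<close>

lemma coloring_determined_by_bits: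
  fixes b :: "nat \<Rightarrow> 'a \<Rightarrow> bool"
  assumes c: "continuous_coloring mtopology c" and K: "compactin mtopology K"
    and sep: "\<And>x y. x \<in> K \<Longrightarrow> y \<in> K \<Longrightarrow> x \<noteq> y \<Longrightarrow> \<exists>i. b i x \<noteq> b i y"
    and lim: "\<And>i \<sigma> l. range \<sigma> \<subseteq> K \<Longrightarrow> l \<in> K \<Longrightarrow> limitin mtopology \<sigma> l sequentially \<Longrightarrow>
      \<forall>\<^sub>F n in sequentially. b i (\<sigma> n) = b i l"
  shows "\<exists>m. \<forall>x\<in>K. \<forall>y\<in>K. \<forall>x'\<in>K. \<forall>y'\<in>K. (\<exists>i<N. b i x \<noteq> b i y) \<longrightarrow>
    (\<forall>i<m. b i x = b i x') \<longrightarrow> (\<forall>i<m. b i y = b i y') \<longrightarrow> c {x, y} = c {x', y'}"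
proof (rule ccontr)
  define bad where "bad m x y x' y' \<longleftrightarrow> x \<in> K \<and> y \<in> K \<and> x' \<in> K \<and> y' \<in> K \<and> (\<exists>i<N. b i x \<noteq> b i y) \<and>
    (\<forall>i<m. b i x = b i x') \<and> (\<forall>i<m. b i y = b i y') \<and> c {x, y} \<noteq> c {x', y'}" for m x y x' y'
  assume neg: "\<not> ?thesis"
  have "\<exists>x y x' y'. bad m x y x' y'" for m
  proof (rule ccontr)
    assume not_bad: "\<not> ?thesis"
    have "\<forall>x\<in>K. \<forall>y\<in>K. \<forall>x'\<in>K. \<forall>y'\<in>K. (\<exists>i<N. b i x \<noteq> b i y) \<longrightarrow>
      (\<forall>i<m. b i x = b i x') \<longrightarrow> (\<forall>i<m. b i y = b i y') \<longrightarrow> c {x, y} = c {x', y'}"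
    proof (intro ballI impI)
      fix x y x' y'
      assume hyp: "x \<in> K" "y \<in> K" "x' \<in> K" "y' \<in> K" "\<exists>i<N. b i x \<noteq> b i y"
        "\<forall>i<m. b i x = b i x'" "\<forall>i<m. b i y = b i y'"
      have "\<not> bad m x y x' y'"
        using not_bad by blast
      then show "c {x, y} = c {x', y'}"
        unfolding bad_def de_Morgan_conj using hyp by (elim disjE) (erule (1) notE | erule notnotD)+
    qed
    then show False
      using neg by (elim notE) (rule exI[of _ m])
  qed
  then obtain x y x' y' where bad: "\<And>m. bad m (x m) (y m) (x' m) (y' m)"
    by metis
  have ran: "range x \<subseteq> K" "range y \<subseteq> K" "range x' \<subseteq> K" "range y' \<subseteq> K"
    using bad unfolding bad_def by blast+
  obtain r l l' where r: "strict_mono r" "l \<in> K" "l' \<in> K"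
    "limitin mtopology (x \<circ> r) l sequentially" "limitin mtopology (x' \<circ> r) l' sequentially"
    by (rule compactin_common_subsequence[OF K ran(1,3)])
  have "range (y \<circ> r) \<subseteq> K" "range (y' \<circ> r) \<subseteq> K"
    using ran by auto
  then obtain q k k' where q: "strict_mono q" "k \<in> K" "k' \<in> K"
    "limitin mtopology (y \<circ> r \<circ> q) k sequentially" "limitin mtopology (y' \<circ> r \<circ> q) k' sequentially"
    by (rule compactin_common_subsequence[OF K])
  define t where "t = r \<circ> q"
  have t: "strict_mono t"
    unfolding t_def using r(1) q(1) by (simp add: strict_mono_o)
  have L: "limitin mtopology (x \<circ> t) l sequentially" "limitin mtopology (x' \<circ> t) l' sequentially"
    "limitin mtopology (y \<circ> t) k sequentially" "limitin mtopology (y' \<circ> t) k' sequentially"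
    using limitin_subsequence[OF q(1) r(4)] limitin_subsequence[OF q(1) r(5)] q(4,5)
    by (simp_all add: t_def o_assoc)
  have rt: "range (x \<circ> t) \<subseteq> K" "range (y \<circ> t) \<subseteq> K" "range (x' \<circ> t) \<subseteq> K" "range (y' \<circ> t) \<subseteq> K"
    using ran by auto
  have large: "\<forall>\<^sub>F n in sequentially. i < t n" for i
    using eventually_gt_at_top[of i]
    by (rule eventually_mono) (rule less_le_trans[OF _ strict_mono_imp_increasing[OF t]])
  have same: "w = w'"
    if w: "range \<sigma> \<subseteq> K" "w \<in> K" "limitin mtopology \<sigma> w sequentially"
      and w': "range \<sigma>' \<subseteq> K" "w' \<in> K" "limitin mtopology \<sigma>' w' sequentially"
      and agree: "\<And>n i. i < t n \<Longrightarrow> b i (\<sigma> n) = b i (\<sigma>' n)" for w w' \<sigma> \<sigma>'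
  proof (rule ccontr)
    assume "w \<noteq> w'"
    then obtain i where i: "b i w \<noteq> b i w'"
      using sep w(2) w'(2) by blast
    have "\<forall>\<^sub>F n in sequentially. False"
      using lim[OF w, of i] lim[OF w', of i] large[of i]
      by eventually_elim (use i agree in metis)
    then show False
      by simp
  qed
  have ll: "l = l'"
    by (rule same[OF rt(1) r(2) L(1) rt(3) r(3) L(2)]) (use bad in \<open>auto simp: bad_def\<close>)
  have kk: "k = k'"
    by (rule same[OF rt(2) q(2) L(3) rt(4) q(3) L(4)]) (use bad in \<open>auto simp: bad_def\<close>)
  have lk: "l \<noteq> k"
  proof
    assume "l = k"
    have "\<forall>i<N. \<forall>\<^sub>F n in sequentially. b i ((x \<circ> t) n) = b i ((y \<circ> t) n)"
    proof (intro allI impI)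
      fix i
      show "\<forall>\<^sub>F n in sequentially. b i ((x \<circ> t) n) = b i ((y \<circ> t) n)"
        using lim[OF rt(1) r(2) L(1), of i] lim[OF rt(2) q(2) L(3), of i]
        by eventually_elim (use \<open>l = k\<close> in simp)
    qed
    then have "\<forall>\<^sub>F n in sequentially. \<forall>i\<in>{..<N}. b i ((x \<circ> t) n) = b i ((y \<circ> t) n)"
      by (intro eventually_ball_finite) auto
    then have "\<forall>\<^sub>F n in sequentially. False"
    proof (rule eventually_mono)
      fix n assume eq: "\<forall>i\<in>{..<N}. b i ((x \<circ> t) n) = b i ((y \<circ> t) n)"
      have "\<exists>i<N. b i (x (t n)) \<noteq> b i (y (t n))"
        using bad[of "t n"] unfolding bad_def by blast
      then show False
        using eq by auto
    qed
    then show False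
      by simp
  qed
  have top: "l \<in> topspace mtopology" "k \<in> topspace mtopology"
    using r(2) q(2) compactin_subset_topspace[OF K] by auto
  obtain U V where UV: "openin mtopology U" "openin mtopology V" "l \<in> U" "k \<in> V" "disjnt U V"
    "\<forall>u\<in>U. \<forall>v\<in>V. c {u, v} = c {l, k}"
    by (rule continuous_coloring_neighbourhoods[OF Hausdorff_space_mtopology c top lk])
  have ev: "\<forall>\<^sub>F n in sequentially. (x \<circ> t) n \<in> U" "\<forall>\<^sub>F n in sequentially. (x' \<circ> t) n \<in> U"
    "\<forall>\<^sub>F n in sequentially. (y \<circ> t) n \<in> V" "\<forall>\<^sub>F n in sequentially. (y' \<circ> t) n \<in> V"
    using L UV(1-4) ll kk unfolding limitin_def by blast+
  have "\<forall>\<^sub>F n in sequentially. False"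
    using ev
  proof eventually_elim
    case (elim n)
    then have "c {x (t n), y (t n)} = c {x' (t n), y' (t n)}"
      using UV(6) by simp
    then show False
      using bad[of "t n"] unfolding bad_def by blast
  qed
  then show False
    by simp
qed

end

section \<open>Covering a complete separable space by compact pieces\<close>

context Metric_space
begin

text \<open>On a piece each ball with center \<open>q a\<close> and radius \<open>1 / (k + 1)\<close> coincides with a smaller closed
  ball, hence is relatively clopen; the second condition makes the piece totally bounded. Both
  conditions weaken as \<open>f\<close> grows.\<close>

definition piece :: "(nat \<Rightarrow> 'a) \<Rightarrow> (nat \<Rightarrow> nat) \<Rightarrow> 'a set" where
  "piece q f = {x \<in> M. (\<forall>a k. d (q a) x < 1 / Suc k \<longrightarrow>
       d (q a) x \<le> 1 / Suc k - 1 / Suc (f (prod_encode (a, k)))) \<and>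
     (\<forall>m. \<exists>j\<le>f m. d (q j) x \<le> 1 / Suc m)}"

lemma piece_mono:
  assumes "\<And>n. f n \<le> h n"
  shows "piece q f \<subseteq> piece q h"
proof
  fix x assume x: "x \<in> piece q f"
  have le: "1 / Suc (h n) \<le> 1 / Suc (f n)" for n
    using assms[of n] by (simp add: frac_le)
  show "x \<in> piece q h"
    unfolding piece_def
  proof (intro CollectI conjI allI impI)
    show "x \<in> M"
      using x by (simp add: piece_def)
    show "d (q a) x \<le> 1 / Suc k - 1 / Suc (h (prod_encode (a, k)))" if "d (q a) x < 1 / Suc k" for a k
    proof -
      have "d (q a) x \<le> 1 / Suc k - 1 / Suc (f (prod_encode (a, k)))"
        using x that unfolding piece_def by blast
      then show ?thesis
        using le[of "prod_encode (a, k)"] by linarith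
    qed
    show "\<exists>j\<le>h m. d (q j) x \<le> 1 / Suc m" for m
    proof -
      obtain j where "j \<le> f m" "d (q j) x \<le> 1 / Suc m"
        using x unfolding piece_def by blast
      then show ?thesis
        using assms[of m] order_trans by blast
    qed
  qed
qed

text \<open>Each condition holds for all large values, by a positive gap or by density, so a sum of
  two witnesses serves both.\<close>

lemma piece_exhausts:
  assumes dense: "\<And>x e. x \<in> M \<Longrightarrow> e > 0 \<Longrightarrow> \<exists>a. d (q a) x < e" and x: "x \<in> M"
  obtains f where "x \<in> piece q f"
proof -
  have "\<exists>n. d (q a) x < 1 / Suc k \<longrightarrow> d (q a) x \<le> 1 / Suc k - 1 / Suc n" for a k
  proof (cases "d (q a) x < 1 / Suc k")
    case True
    then have "1 / Suc k - d (q a) x > 0"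
      by simp
    then obtain n where "1 / Suc n < 1 / Suc k - d (q a) x"
      by (rule nat_approx_posE)
    then show ?thesis
      by (intro exI[of _ n]) simp
  qed simp
  then obtain u where u: "\<And>a k. d (q a) x < 1 / Suc k \<Longrightarrow> d (q a) x \<le> 1 / Suc k - 1 / Suc (u a k)"
    by metis
  have "\<exists>j. d (q j) x \<le> 1 / Suc m" for m
    using dense[OF x, of "1 / Suc m"] by (auto intro: less_imp_le)
  then obtain v where v: "\<And>m. d (q (v m)) x \<le> 1 / Suc m"
    by metis
  define f where "f n = u (fst (prod_decode n)) (snd (prod_decode n)) + v n" for n
  show ?thesis
  proof (rule that[of f], unfold piece_def, intro CollectI conjI allI impI x)
    show "d (q a) x \<le> 1 / Suc k - 1 / Suc (f (prod_encode (a, k)))" if "d (q a) x < 1 / Suc k" for a k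
    proof -
      have "1 / Suc (f (prod_encode (a, k))) \<le> 1 / Suc (u a k)"
        by (intro frac_le) (simp_all add: f_def)
      then show ?thesis
        using u[OF that] by linarith
    qed
    show "\<exists>j\<le>f m. d (q j) x \<le> 1 / Suc m" for m
      using v[of m] by (intro exI[of _ "v m"]) (simp add: f_def)
  qed
qed

lemma compactin_piece:
  assumes mc: "mcomplete" and q: "\<And>a. q a \<in> M"
  shows "compactin mtopology (piece q f)"
proof -
  let ?A = "\<lambda>(a, k). (M - mball (q a) (1 / Suc k)) \<union> mcball (q a) (1 / Suc k - 1 / Suc (f (prod_encode (a, k))))"
  let ?B = "\<lambda>m. \<Union>j\<in>{..f m}. mcball (q j) (1 / Suc m)"
  have "piece q f = (\<Inter>p. ?A p) \<inter> (\<Inter>m. ?B m)"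
  proof (intro set_eqI iffI)
    fix x assume "x \<in> piece q f"
    then show "x \<in> (\<Inter>p. ?A p) \<inter> (\<Inter>m. ?B m)"
      using q by (auto simp: piece_def)
  next
    fix x assume x: "x \<in> (\<Inter>p. ?A p) \<inter> (\<Inter>m. ?B m)"
    have A: "x \<in> ?A (a, k)" for a k
      using x by blast
    have B: "x \<in> ?B m" for m
      using x by blast
    show "x \<in> piece q f"
      unfolding piece_def
    proof (intro CollectI conjI allI impI)
      show xM: "x \<in> M"
        using A[of 0 0] by auto
      show "d (q a) x \<le> 1 / Suc k - 1 / Suc (f (prod_encode (a, k)))" if "d (q a) x < 1 / Suc k" for a k
        using A[of a k] that xM q[of a] by auto
      show "\<exists>j\<le>f m. d (q j) x \<le> 1 / Suc m" for m
        using B[of m] by auto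
    qed
  qed
  moreover have "closedin mtopology ((\<Inter>p. ?A p) \<inter> (\<Inter>m. ?B m))"
  proof (intro closedin_Int closedin_INT)
    fix p :: "nat \<times> nat"
    have "closedin mtopology (M - mball a r)" for a r
      using closedin_diff[OF closedin_topspace openin_mball, of a r] by simp
    then show "closedin mtopology (?A p)"
      by (cases p) (auto intro!: closedin_Un)
  next
    show "closedin mtopology (?B m)" for m
      by (intro closedin_Union) auto
  qed auto
  ultimately have closed: "closedin mtopology (piece q f)"
    by simp
  have "mtotally_bounded (piece q f)"
    unfolding mtotally_bounded_def
  proof (intro allI impI)
    fix e :: real assume "e > 0"
    then obtain m where m: "1 / Suc m < e / 2"
      using nat_approx_posE[of "e / 2"] by auto
    \<comment> \<open>Total boundedness asks for centers inside the piece. Replacing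
      \<open>q j\<close> by a point of the piece doubles the radius, hence
      \<open>e / 2\<close>.\<close>
    define J where "J = {j. j \<le> f m \<and> (\<exists>x\<in>piece q f. d (q j) x \<le> 1 / Suc m)}"
    have "\<forall>j\<in>J. \<exists>x. x \<in> piece q f \<and> d (q j) x \<le> 1 / Suc m"
      unfolding J_def by blast
    then obtain g where g: "\<And>j. j \<in> J \<Longrightarrow> g j \<in> piece q f \<and> d (q j) (g j) \<le> 1 / Suc m"
      by metis
    show "\<exists>K. finite K \<and> K \<subseteq> piece q f \<and> piece q f \<subseteq> (\<Union>x\<in>K. mball x e)"
    proof (intro exI[of _ "g ` J"] conjI)
      show "finite (g ` J)"
        by (simp add: J_def)
      show "g ` J \<subseteq> piece q f"
        using g by blast
      show "piece q f \<subseteq> (\<Union>x\<in>g ` J. mball x e)"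
      proof
        fix x assume x: "x \<in> piece q f"
        then obtain j where j: "j \<le> f m" "d (q j) x \<le> 1 / Suc m"
          unfolding piece_def by blast
        then have jJ: "j \<in> J"
          using x unfolding J_def by blast
        have M: "x \<in> M" "g j \<in> M"
          using x g[OF jJ] by (auto simp: piece_def)
        have "d (g j) x \<le> d (q j) (g j) + d (q j) x"
          using triangle'[of "g j" "q j" x] M q by (simp add: commute)
        then have "d (g j) x < e"
          using g[OF jJ] j(2) m by linarith
        then show "x \<in> (\<Union>x\<in>g ` J. mball x e)"
          using M jJ by auto
      qed
    qed
  qed
  then have "compactin mtopology (mtopology closure_of (piece q f))"
    using mtotally_bounded_eq_compact_closure_of[OF mc] by blast
  then show ?thesis
    using closed by (simp add: closure_of_eq[THEN iffD2])
qed

text \<open>hm(c_max) bounds the number of pieces, through the dominating family, and the cover of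
  each piece; being infinite, it bounds the union of these covers.\<close>

lemma hm_le_c_max_separable:
  fixes q :: "nat \<Rightarrow> 'a"
  assumes mc: "mcomplete" and c: "continuous_coloring mtopology c" and adj: "random_graph adj"
    and q: "\<And>a. q a \<in> M" and dense: "\<And>x e. x \<in> M \<Longrightarrow> e > 0 \<Longrightarrow> \<exists>a. d (q a) x < e"
  shows "hm M c \<le>o hm max_space (c_max adj)"
proof -
  obtain F where F: "homogeneous_cover max_space (c_max adj) F" "hm max_space (c_max adj) = |F|"
    by (rule hm_cover)
  obtain G where G: "homogeneous_cover cantor_space c_min G" "hm cantor_space c_min = |G|"
    by (rule hm_cover)
  have GF: "|G| \<le>o |F|"
    using hm_c_min_le_c_max[OF adj] F(2) G(2) by simp
  have inf: "infinite F"
    using card_of_ordLeq_infinite[OF GF c_min_cover_infinite[OF G(1)]] .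
  obtain D :: "(nat \<Rightarrow> nat) set" where D: "|D| \<le>o |G|" "\<And>f. \<exists>h\<in>D. \<forall>n. f n \<le> h n"
    using dominating_family_of_c_min_cover[OF G(1)] by blast
  define b where "b i x \<longleftrightarrow> d (q (fst (prod_decode i))) x < 1 / Suc (snd (prod_decode i))" for i x
  have b_encode: "b (prod_encode (a, k)) x \<longleftrightarrow> d (q a) x < 1 / Suc k" for a k x
    by (simp add: b_def)
  have bound: "hm (piece q h) c \<le>o |F|" for h
  proof (rule hm_le_c_max_of_bits[OF adj _ _ _ inf F(2), where b = b])
    have sub: "piece q h \<subseteq> M"
      by (auto simp: piece_def)
    show sep: "\<exists>i. b i x \<noteq> b i y" if xy: "x \<in> piece q h" "y \<in> piece q h" "x \<noteq> y" for x y
    proof -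
      have M: "x \<in> M" "y \<in> M"
        using xy sub by auto
      then have "d x y / 2 > 0"
        using xy(3) by (simp add: mdist_pos_less)
      then obtain k where k: "1 / Suc k < d x y / 2"
        by (rule nat_approx_posE)
      obtain a where a: "d (q a) x < 1 / Suc k"
        using dense[OF M(1), of "1 / Suc k"] by auto
      have "d x y \<le> d (q a) x + d (q a) y"
        using triangle'[of x "q a" y] M q by (simp add: commute)
      then have "\<not> d (q a) y < 1 / Suc k"
        using a k by linarith
      then show ?thesis
        using a b_encode by blast
    qed
    show "c {x, y} \<in> {0, 1}" if "x \<in> piece q h" "y \<in> piece q h" "x \<noteq> y" for x y
      using that sub by (intro continuous_coloring_01[OF c]) auto
    show "\<exists>m. \<forall>x\<in>piece q h. \<forall>y\<in>piece q h. \<forall>x'\<in>piece q h. \<forall>y'\<in>piece q h. (\<exists>i<N. b i x \<noteq> b i y) \<longrightarrow>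
        (\<forall>i<m. b i x = b i x') \<longrightarrow> (\<forall>i<m. b i y = b i y') \<longrightarrow> c {x, y} = c {x', y'}" for N
    proof (rule coloring_determined_by_bits[OF c compactin_piece[OF mc q] sep])
      fix i \<sigma> l
      assume \<sigma>: "range \<sigma> \<subseteq> piece q h" and l: "l \<in> piece q h" and lim: "limitin mtopology \<sigma> l sequentially"
      obtain a k where i: "i = prod_encode (a, k)"
        by (metis prod_decode_inverse surj_pair)
      have lM: "l \<in> M"
        using l sub by blast
      show "\<forall>\<^sub>F n in sequentially. b i (\<sigma> n) = b i l"
      proof (cases "b i l")
        case True
        then have "l \<in> mball (q a) (1 / Suc k)"
          using lM q by (simp add: i b_encode)
        then have "\<forall>\<^sub>F n in sequentially. \<sigma> n \<in> mball (q a) (1 / Suc k)"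
          using lim openin_mball unfolding limitin_def by blast
        then show ?thesis
          by (rule eventually_mono) (use True in \<open>simp add: i b_encode\<close>)
      next
        case False
        \<comment> \<open>A limit outside the open ball has distance at least
          \<open>1 / Suc k\<close>, so it lies in the open complement of \<open>?C\<close>. Inside
          the piece this complement misses the ball, by the gap.\<close>
        let ?C = "mcball (q a) (1 / Suc k - 1 / Suc (h i))"
        have "openin mtopology (M - ?C)"
          using closedin_mcball[of "q a" "1 / Suc k - 1 / Suc (h i)"] by (simp add: closedin_def)
        moreover have "l \<in> M - ?C"
        proof -
          have "\<not> d (q a) l < 1 / Suc k"
            using False by (simp only: i b_encode not_False_eq_True)
          moreover have "0 < 1 / real (Suc (h i))"
            by simp
          ultimately have "\<not> d (q a) l \<le> 1 / Suc k - 1 / Suc (h i)"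
            by linarith
          then show ?thesis
            using lM by (simp del: of_nat_Suc)
        qed
        ultimately have "\<forall>\<^sub>F n in sequentially. \<sigma> n \<in> M - ?C"
          using lim unfolding limitin_def by blast
        then show ?thesis
        proof (rule eventually_mono)
          fix n assume n: "\<sigma> n \<in> M - ?C"
          have "\<sigma> n \<in> piece q h"
            using \<sigma> by blast
          then have "d (q a) (\<sigma> n) < 1 / Suc k \<Longrightarrow> d (q a) (\<sigma> n) \<le> 1 / Suc k - 1 / Suc (h i)"
            unfolding piece_def i by blast
          then have "\<not> b i (\<sigma> n)"
            using n q[of a] unfolding i b_encode by auto
          then show "b i (\<sigma> n) = b i l"
            using False by simp
        qed
      qed
    qed
  qed
  have "\<exists>C. homogeneous_cover (piece q h) c C \<and> |C| \<le>o |F|" for h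
    using bound[of h] hm_cover[of "piece q h" c] by metis
  then obtain C where C: "\<And>h. homogeneous_cover (piece q h) c (C h)" "\<And>h. |C h| \<le>o |F|"
    by metis
  have "hm M c \<le>o |SIGMA h:D. C h|"
  proof (rule hm_leI[where H = snd])
    fix x assume x: "x \<in> M"
    obtain f where "x \<in> piece q f"
      using piece_exhausts[of q x, OF dense x] by blast
    moreover obtain h where "h \<in> D" "\<forall>n. f n \<le> h n"
      using D(2) by blast
    ultimately have "x \<in> piece q h"
      using piece_mono[of f h q] by blast
    then obtain H where "H \<in> C h" "x \<in> H"
      using homogeneous_cover_mem[OF C(1)] by blast
    then show "\<exists>p\<in>SIGMA h:D. C h. x \<in> snd p"
      using \<open>h \<in> D\<close> by force
  next
    fix p assume "p \<in> (SIGMA h:D. C h)"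
    then obtain h where "snd p \<in> C h"
      by auto
    then have "homogeneous c (snd p)"
      using C(1)[of h] by (simp add: homogeneous_cover_def)
    then show "homogeneous c (snd p \<inter> M)"
      by (rule homogeneous_subset) blast
  qed
  also have "|SIGMA h:D. C h| \<le>o |F|"
    using inf ordLeq_transitive[OF D(1) GF] C(2) by (intro card_of_Sigma_ordLeq_infinite) auto
  finally show ?thesis
    using F(2) by simp
qed

end

section \<open>The dichotomy\<close>

theorem mainTheorem1:
  fixes X :: "'a topology" and c :: "'a set \<Rightarrow> nat" and adj :: "nat set \<Rightarrow> nat"
  assumes "Polish_space X"
    and "topspace X \<noteq> {}"
    and "reduced_coloring X c"
    and "random_graph adj"
  shows "hm (topspace X) c =o hm cantor_space c_min \<or>
         hm (topspace X) c =o hm max_space (c_max adj)"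
proof -
  obtain M d where M: "Metric_space M d" "Metric_space.mcomplete M d" "X = Metric_space.mtopology M d"
    using assms(1) unfolding Polish_space_def completely_metrizable_space_def by blast
  interpret Metric_space M d
    by (rule M(1))
  have top: "topspace X = M"
    by (simp add: M(3))
  have ne: "M \<noteq> {}"
    using assms(2) top by simp
  have red: "reduced_coloring mtopology c"
    using assms(3) M(3) by simp
  have lower: "hm cantor_space c_min \<le>o hm (topspace X) c"
    unfolding top by (rule hm_c_min_le_reduced[OF M(2) ne red])
  obtain S where S: "countable S" "S \<subseteq> M" "mtopology closure_of S = M"
    using assms(1) M(3) top unfolding Polish_space_def separable_space_def by auto
  have "S \<noteq> {}"
    using S(3) ne by auto
  have upper: "hm (topspace X) c \<le>o hm max_space (c_max adj)"
    unfolding top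
  proof (rule hm_le_c_max_separable[OF M(2) _ assms(4), where q = "from_nat_into S"])
    show "continuous_coloring mtopology c"
      using red by (simp add: reduced_coloring_def)
    show "from_nat_into S a \<in> M" for a
      using from_nat_into[OF \<open>S \<noteq> {}\<close>] S(2) by blast
    fix x e assume "x \<in> M" "(e :: real) > 0"
    then have "x \<in> mtopology closure_of S"
      using S(3) by simp
    then obtain y where "y \<in> S" "y \<in> mball x e"
      using \<open>e > 0\<close> unfolding metric_closure_of by blast
    then show "\<exists>a. d (from_nat_into S a) x < e"
      using from_nat_into_surj[OF S(1), of y] by (auto simp: commute)
  qed
  obtain F where F: "homogeneous_cover cantor_space c_min F" "hm cantor_space c_min = |F|"
    by (rule hm_cover)
  obtain G where G: "homogeneous_cover (topspace X) c G" "hm (topspace X) c = |G|"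
    by (rule hm_cover)
  obtain H where H: "homogeneous_cover max_space (c_max adj) H" "hm max_space (c_max adj) = |H|"
    by (rule hm_cover)
  have FG: "|F| \<le>o |G|" and GH: "|G| \<le>o |H|"
    using lower upper F(2) G(2) H(2) by simp_all
  have "|H| \<le>o |G|" if FG_lt: "|F| <o |G|"
  proof -
    have H_le: "|H| \<le>o |UNIV :: (nat \<Rightarrow> bool) set|"
      using ordLeq_transitive[OF hm_le_card nat_seq_card_le_bool_seq, of max_space "c_max adj"] H(2) by simp
    have "|G| \<le>o |UNIV :: (nat \<Rightarrow> bool) set|"
      using ordLeq_transitive[OF GH H_le] .
    \<comment> \<open>The continuum bound needs a set of binary sequences, so \<open>G\<close> is
      copied into them.\<close>
    then have "\<exists>g :: 'a set \<Rightarrow> nat \<Rightarrow> bool. inj_on g G \<and> g ` G \<subseteq> UNIV"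
      by (simp only: card_of_ordLeq)
    then obtain g :: "'a set \<Rightarrow> nat \<Rightarrow> bool" where g: "inj_on g G"
      by (elim exE conjE)
    have iso: "|G| =o |g ` G|"
      using g by (intro card_of_ordIsoI[of g]) (simp add: bij_betw_def)
    have "infinite G"
      using card_of_ordLeq_infinite[OF FG c_min_cover_infinite[OF F(1)]] .
    then have "infinite (g ` G)"
      using finite_imageD g by blast
    moreover have "|F| <o |g ` G|"
      by (rule ordLess_ordIso_trans[OF FG_lt iso])
    ultimately have "|UNIV :: (nat \<Rightarrow> bool) set| \<le>o |g ` G|"
      by (rule continuum_le_of_c_min_cover[OF F(1)])
    then show ?thesis
      using ordLeq_transitive[OF H_le] ordLeq_transitive[OF _ card_of_image] by blast
  qed
  then show ?thesis
    using FG GH unfolding F(2) G(2) H(2)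
    by (metis ordIso_iff_ordLeq ordLeq_iff_ordLess_or_ordIso ordIso_symmetric)
qed

end
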